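(* The following hold. (1) For every total $0$-$1$ matrix $M$, if $\operatorname{rank}_+(M)\le 3$ then $\operatorname{rank}_+(M)=\operatorname{rank}_{0,1}(M)$. (2) There exists a total $0$-$1$ matrix $M$ such that $\operatorname{rank}_+(M)=4$ and $\operatorname{rank}_{0,1}(M)=5$. (3) There exists a total $0$-$1$ matrix $M$ such that $\operatorname{rank}_+(M)=9$ and $\operatorname{rank}_{0,1}(M)=12$.
   Context: A total $0$-$1$ matrix is a finite matrix all of whose entries are in $\{0,1\}$. For a total $0$-$1$ matrix $M$ of size $n\times m$: the nonnegative rank $\operatorname{rank}_+(M)$ is the smallest $r$ such that $M=UV$ with $U$ an $n\times r$ and $V$ an $r\times m$ real matrix, both entrywise nonnegative; the binary rank $\operatorname{rank}_{0,1}(M)$ is the smallest $r$ such that $M=UV$ (ordinary arithmetic over the reals) with $U$ an $n\times r$ and $V$ an $r\times m$ matrix, both with all entries in $\{0,1\}$. *)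

theory Defs
  imports Complex_Main "Jordan_Normal_Form.Matrix"
begin

definition zero_one_mat :: "real mat \<Rightarrow> bool" where
  "zero_one_mat M \<longleftrightarrow> elements_mat M \<subseteq> {0, 1}"

definition nonneg_mat :: "real mat \<Rightarrow> bool" where
  "nonneg_mat M \<longleftrightarrow> elements_mat M \<subseteq> {0..}"

text \<open>Inner dimension \<open>r = 0\<close> is allowed; such a product is the zero matrix.
  Both ranks are unspecified if no factorization exists, which cannot happen for
  0-1 matrices, see \<open>nonneg_rank_attained\<close> and \<open>binary_rank_attained\<close> below.\<close>

definition nonneg_rank :: "real mat \<Rightarrow> nat" where
  "nonneg_rank M = (LEAST r. \<exists>U \<in> carrier_mat (dim_row M) r. \<exists>V \<in> carrier_mat r (dim_col M).
     nonneg_mat U \<and> nonneg_mat V \<and> M = U * V)"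

definition binary_rank :: "real mat \<Rightarrow> nat" where
  "binary_rank M = (LEAST r. \<exists>U \<in> carrier_mat (dim_row M) r. \<exists>V \<in> carrier_mat r (dim_col M).
     zero_one_mat U \<and> zero_one_mat V \<and> M = U * V)"

lemma zero_one_mat_one: "zero_one_mat (1\<^sub>m n)"
  unfolding zero_one_mat_def by (auto dest!: elements_matD split: if_splits)

lemma zero_one_mat_imp_nonneg_mat: "zero_one_mat M \<Longrightarrow> nonneg_mat M"
  unfolding zero_one_mat_def nonneg_mat_def by fastforce

lemma binary_rank_attained:
  assumes "zero_one_mat M"
  shows "\<exists>U \<in> carrier_mat (dim_row M) (binary_rank M).
    \<exists>V \<in> carrier_mat (binary_rank M) (dim_col M).
      zero_one_mat U \<and> zero_one_mat V \<and> M = U * V"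
proof -
  have "\<exists>U \<in> carrier_mat (dim_row M) (dim_col M). \<exists>V \<in> carrier_mat (dim_col M) (dim_col M).
     zero_one_mat U \<and> zero_one_mat V \<and> M = U * V"
    by (intro bexI[of _ M] bexI[of _ "1\<^sub>m (dim_col M)"]) (use assms zero_one_mat_one in auto)
  then show ?thesis
    unfolding binary_rank_def by (rule LeastI)
qed

lemma nonneg_rank_attained:
  assumes "zero_one_mat M"
  shows "\<exists>U \<in> carrier_mat (dim_row M) (nonneg_rank M).
    \<exists>V \<in> carrier_mat (nonneg_rank M) (dim_col M).
      nonneg_mat U \<and> nonneg_mat V \<and> M = U * V"
proof -
  have "\<exists>U \<in> carrier_mat (dim_row M) (dim_col M). \<exists>V \<in> carrier_mat (dim_col M) (dim_col M).
     nonneg_mat U \<and> nonneg_mat V \<and> M = U * V"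
    by (intro bexI[of _ M] bexI[of _ "1\<^sub>m (dim_col M)"])
      (use assms zero_one_mat_one zero_one_mat_imp_nonneg_mat in auto)
  then show ?thesis
    unfolding nonneg_rank_def by (rule LeastI)
qed

end

(* Rank at most 3: among the nonnegative factorizations M = U V of minimal inner dimension choose
   one whose V has the most zeros; then no row of V has its support inside that of another, since
   otherwise subtracting a multiple of the former from the latter creates new zeros. If every
   coordinate axis carries a column of V, then U becomes 0-1 after rescaling, and either V is 0-1
   as well, or the rows of U form an antichain in {0,1}^3, so that M has at most three distinct
   nonzero rows. Otherwise V has enough columns supported on two coordinates to leave at most four
   row patterns. If one of them is missing, M again has at most three distinct nonzero rows;
   if all occur, every axis carries a row of U, which is the first case for the transpose.

   The examples are incidence matrices of a set system, extended by columns that are half the sum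
   of some of the point columns; fooling sets bound the nonnegative rank from below. A 0-1
   factorization is a family of blocks (column sets) such that every row is a disjoint union of
   blocks, and the blocks are counted according to the points that they contain. *)

theory Submission
  imports Defs
begin

section \<open>Factorizations with entries in a set \<open>A\<close>, and the two ranks as least
  inner dimensions\<close>

definition factorizes :: "real set \<Rightarrow> nat \<Rightarrow> nat \<Rightarrow> nat \<Rightarrow> (nat \<Rightarrow> nat \<Rightarrow> real) \<Rightarrow> bool" where
  "factorizes A r n m F \<longleftrightarrow> (\<exists>U V. (\<forall>i<n. \<forall>k<r. U i k \<in> A) \<and> (\<forall>k<r. \<forall>j<m. V k j \<in> A)
     \<and> (\<forall>i<n. \<forall>j<m. F i j = (\<Sum>k<r. U i k * V k j)))"

text \<open>Bridge to matrices: with \<open>A\<close> equal to \<open>{0..}\<close> or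
  \<open>{0, 1}\<close>, either rank becomes the least \<open>r\<close> with
  \<open>factorizes A r\<close>, so that the arguments below can use index functions.\<close>

lemma factorizes_mat_iff:
  "factorizes A r (dim_row M) (dim_col M) (\<lambda>i j. M $$ (i, j)) \<longleftrightarrow>
    (\<exists>U \<in> carrier_mat (dim_row M) r. \<exists>V \<in> carrier_mat r (dim_col M).
      elements_mat U \<subseteq> A \<and> elements_mat V \<subseteq> A \<and> M = U * V)"
  (is "?L \<longleftrightarrow> ?R")
proof
  assume ?L
  then obtain U V where U: "\<forall>i<dim_row M. \<forall>k<r. U i k \<in> A"
    and V: "\<forall>k<r. \<forall>j<dim_col M. V k j \<in> A"
    and M: "\<forall>i<dim_row M. \<forall>j<dim_col M. M $$ (i, j) = (\<Sum>k<r. U i k * V k j)"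
    unfolding factorizes_def by blast
  define U' where "U' = mat (dim_row M) r (\<lambda>(i, k). U i k)"
  define V' where "V' = mat r (dim_col M) (\<lambda>(k, j). V k j)"
  have "elements_mat U' \<subseteq> A" "elements_mat V' \<subseteq> A"
    using U V by (auto simp: U'_def V'_def elements_mat_def)
  moreover have "M = U' * V'"
    using M by (intro eq_matI)
      (auto simp: U'_def V'_def scalar_prod_def atLeast0LessThan)
  moreover have "U' \<in> carrier_mat (dim_row M) r" "V' \<in> carrier_mat r (dim_col M)"
    by (auto simp: U'_def V'_def)
  ultimately show ?R by blast
next
  assume ?R
  then obtain U V where c: "U \<in> carrier_mat (dim_row M) r" "V \<in> carrier_mat r (dim_col M)"
    and A: "elements_mat U \<subseteq> A" "elements_mat V \<subseteq> A" and M: "M = U * V"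
    by blast
  have "M $$ (i, j) = (\<Sum>k<r. U $$ (i, k) * V $$ (k, j))" if "i < dim_row M" "j < dim_col M" for i j
    using that c by (subst M) (auto simp: scalar_prod_def atLeast0LessThan)
  moreover have "U $$ (i, k) \<in> A" if "i < dim_row M" "k < r" for i k
    using elements_matI[OF c(1) that refl] A(1) by blast
  moreover have "V $$ (k, j) \<in> A" if "k < r" "j < dim_col M" for k j
    using elements_matI[OF c(2) that refl] A(2) by blast
  ultimately show ?L
    unfolding factorizes_def
    by (intro exI[of _ "\<lambda>i k. U $$ (i, k)"] exI[of _ "\<lambda>k j. V $$ (k, j)"]) auto
qed

lemma nonneg_rank_eq_Least:
  "nonneg_rank M = (LEAST r. factorizes {0..} r (dim_row M) (dim_col M) (\<lambda>i j. M $$ (i, j)))"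
  unfolding nonneg_rank_def factorizes_mat_iff nonneg_mat_def by (rule refl)

lemma binary_rank_eq_Least:
  "binary_rank M = (LEAST r. factorizes {0, 1} r (dim_row M) (dim_col M) (\<lambda>i j. M $$ (i, j)))"
  unfolding binary_rank_def factorizes_mat_iff zero_one_mat_def by (rule refl)

lemma factorizes_nonneg_rank:
  assumes "zero_one_mat M"
  shows "factorizes {0..} (nonneg_rank M) (dim_row M) (dim_col M) (\<lambda>i j. M $$ (i, j))"
  using nonneg_rank_attained[OF assms] unfolding factorizes_mat_iff nonneg_mat_def .

lemma factorizes_binary_rank:
  assumes "zero_one_mat M"
  shows "factorizes {0, 1} (binary_rank M) (dim_row M) (dim_col M) (\<lambda>i j. M $$ (i, j))"
  using binary_rank_attained[OF assms] unfolding factorizes_mat_iff zero_one_mat_def .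

lemma nonneg_rank_le:
  assumes "factorizes {0..} r (dim_row M) (dim_col M) (\<lambda>i j. M $$ (i, j))"
  shows "nonneg_rank M \<le> r"
  unfolding nonneg_rank_eq_Least by (rule Least_le) (rule assms)

lemma binary_rank_le:
  assumes "factorizes {0, 1} r (dim_row M) (dim_col M) (\<lambda>i j. M $$ (i, j))"
  shows "binary_rank M \<le> r"
  unfolding binary_rank_eq_Least by (rule Least_le) (rule assms)

lemma factorizes_mono:
  assumes "factorizes A r n m F" "A \<subseteq> B"
  shows "factorizes B r n m F"
proof -
  from assms(1) obtain U V where "\<forall>i<n. \<forall>k<r. U i k \<in> A" "\<forall>k<r. \<forall>j<m. V k j \<in> A"
    "\<forall>i<n. \<forall>j<m. F i j = (\<Sum>k<r. U i k * V k j)"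
    unfolding factorizes_def by blast
  with assms(2) show ?thesis
    unfolding factorizes_def by (intro exI[of _ U] exI[of _ V]) auto
qed

lemma factorizes_transpose:
  assumes "factorizes A r n m F"
  shows "factorizes A r m n (\<lambda>j i. F i j)"
proof -
  from assms obtain U V where "\<forall>i<n. \<forall>k<r. U i k \<in> A" "\<forall>k<r. \<forall>j<m. V k j \<in> A"
    "\<forall>i<n. \<forall>j<m. F i j = (\<Sum>k<r. U i k * V k j)"
    unfolding factorizes_def by blast
  then show ?thesis
    unfolding factorizes_def
    by (intro exI[of _ "\<lambda>j k. V k j"] exI[of _ "\<lambda>k i. U i k"]) (auto simp: mult.commute)
qed

text \<open>Frees the inner index from being an initial segment, so that an index can be deleted, or
  replaced by a set of colours, without renumbering.\<close>

lemma factorizes_cardI: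
  assumes "finite K"
    and U: "\<And>i k. i < n \<Longrightarrow> k \<in> K \<Longrightarrow> U i k \<in> A"
    and V: "\<And>k j. k \<in> K \<Longrightarrow> j < m \<Longrightarrow> V k j \<in> A"
    and F: "\<And>i j. i < n \<Longrightarrow> j < m \<Longrightarrow> F i j = (\<Sum>k\<in>K. U i k * V k j)"
  shows "factorizes A (card K) n m F"
proof -
  obtain h where h: "bij_betw h {..<card K} K"
    using ex_bij_betw_nat_finite[OF \<open>finite K\<close>] by (auto simp: atLeast0LessThan)
  then have hK: "h k \<in> K" if "k < card K" for k
    using that by (auto simp: bij_betw_def)
  have "F i j = (\<Sum>k<card K. U i (h k) * V (h k) j)" if "i < n" "j < m" for i j
    using F[OF that] sum.reindex_bij_betw[OF h, of "\<lambda>k. U i k * V k j"] by simp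
  then show ?thesis
    unfolding factorizes_def
    by (intro exI[of _ "\<lambda>i k. U i (h k)"] exI[of _ "\<lambda>k. V (h k)"]) (use U V hK in auto)
qed

lemma factorizes_pad:
  assumes "factorizes A s n m F" "s \<le> r" "0 \<in> A"
  shows "factorizes A r n m F"
proof -
  from assms(1) obtain U V where U: "\<forall>i<n. \<forall>k<s. U i k \<in> A" and V: "\<forall>k<s. \<forall>j<m. V k j \<in> A"
    and F: "\<forall>i<n. \<forall>j<m. F i j = (\<Sum>k<s. U i k * V k j)"
    unfolding factorizes_def by blast
  define U' where "U' i k = (if k < s then U i k else 0)" for i k
  define V' where "V' k j = (if k < s then V k j else 0)" for k j
  have "(\<Sum>k<r. U' i k * V' k j) = (\<Sum>k<s. U i k * V k j)" for i j
    using assms(2) by (intro sum.mono_neutral_cong_right) (auto simp: U'_def V'_def)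
  then show ?thesis
    unfolding factorizes_def
    by (intro exI[of _ U'] exI[of _ V']) (use U V F assms(3) in \<open>auto simp: U'_def V'_def\<close>)
qed

text \<open>\<open>V\<close> consists of one representative per colour class of nonzero rows, and
  \<open>U\<close> records the colour of each row; zero rows select nothing. It is applied below
  with three colours.\<close>

lemma factorizes_few_rows:
  assumes zero_one: "\<And>i j. i < n \<Longrightarrow> j < m \<Longrightarrow> F i j \<in> {0, 1}"
    and C: "finite C" "card C \<le> r"
    and c: "\<And>i. i < n \<Longrightarrow> \<exists>j<m. F i j \<noteq> 0 \<Longrightarrow> c i \<in> C"
    and same: "\<And>i i' j. i < n \<Longrightarrow> i' < n \<Longrightarrow> \<exists>j<m. F i j \<noteq> 0 \<Longrightarrow> \<exists>j<m. F i' j \<noteq> 0 \<Longrightarrow>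
      c i = c i' \<Longrightarrow> j < m \<Longrightarrow> F i j = F i' j"
  shows "factorizes {0, 1} r n m F"
proof -
  define P where "P i k \<longleftrightarrow> i < n \<and> (\<exists>j<m. F i j \<noteq> 0) \<and> c i = k" for i k
  define U where "U i k = (if P i k then 1 else (0 :: real))" for i k
  define V where "V k j = (if \<exists>i. P i k then F (SOME i. P i k) j else 0)" for k j
  have P_some: "P (SOME i. P i k) k" if "P i k" for i k
    using that by (rule someI)
  have "F i j = (\<Sum>k\<in>C. U i k * V k j)" if ij: "i < n" "j < m" for i j
  proof (cases "\<exists>j<m. F i j \<noteq> 0")
    case False
    then have "U i k = 0" for k
      by (auto simp: U_def P_def)
    with False ij show ?thesis
      by simp
  next
    case True
    then have Pi: "P i (c i)"
      using ij by (auto simp: P_def)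
    have "(\<Sum>k\<in>C. U i k * V k j) = (\<Sum>k\<in>C. if k = c i then V (c i) j else 0)"
      using Pi by (intro sum.cong) (auto simp: U_def P_def)
    also have "\<dots> = V (c i) j"
      using C c[OF ij(1) True] by simp
    also have "\<dots> = F (SOME i'. P i' (c i)) j"
      using Pi by (auto simp: V_def)
    also have "\<dots> = F i j"
      using P_some[OF Pi] ij True by (intro same) (auto simp: P_def)
    finally show ?thesis by simp
  qed
  moreover have "V k j \<in> {0, 1}" if "j < m" for k j
    using zero_one[of "SOME i. P i k" j] P_some[of _ k] that by (auto simp: V_def P_def)
  ultimately have "factorizes {0, 1} (card C) n m F"
    using C by (intro factorizes_cardI[of C n U]) (auto simp: U_def)
  then show ?thesis
    using C(2) by (rule factorizes_pad) simp
qed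

subsection \<open>Nonnegative rank at most three\<close>

text \<open>By \<open>minimal\<close>, the inner dimension \<open>r\<close> is the nonnegative rank,
  so any modification that saves an inner index is a contradiction.\<close>

locale minimal_factorization =
  fixes n m r :: nat and F U V :: "nat \<Rightarrow> nat \<Rightarrow> real"
  assumes zero_one: "\<And>i j. i < n \<Longrightarrow> j < m \<Longrightarrow> F i j \<in> {0, 1}"
    and U_nonneg: "\<And>i k. i < n \<Longrightarrow> k < r \<Longrightarrow> 0 \<le> U i k"
    and V_nonneg: "\<And>k j. k < r \<Longrightarrow> j < m \<Longrightarrow> 0 \<le> V k j"
    and F_eq: "\<And>i j. i < n \<Longrightarrow> j < m \<Longrightarrow> F i j = (\<Sum>k<r. U i k * V k j)"
    and minimal: "\<And>s. s < r \<Longrightarrow> \<not> factorizes {0..} s n m F"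
begin

lemma transposed: "minimal_factorization m n r (\<lambda>j i. F i j) (\<lambda>j k. V k j) (\<lambda>k i. U i k)"
proof
  show "\<not> factorizes {0..} s m n (\<lambda>j i. F i j)" if "s < r" for s
    using minimal[OF that] factorizes_transpose[of "{0..}" s m n "\<lambda>j i. F i j"] by blast
qed (use zero_one U_nonneg V_nonneg F_eq in \<open>auto simp: mult.commute\<close>)

lemma V_row_nonzero:
  assumes k: "k < r"
  shows "\<exists>j<m. V k j > 0"
proof (rule ccontr)
  assume "\<not> ?thesis"
  with V_nonneg[OF k] have V0: "V k j = 0" if "j < m" for j
    using that by (meson antisym_conv2 not_less)
  have "F i j = (\<Sum>l\<in>{..<r} - {k}. U i l * V l j)" if "i < n" "j < m" for i j
    unfolding F_eq[OF that] using V0[OF that(2)] k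
    by (intro sum.mono_neutral_right) auto
  then have "factorizes {0..} (card ({..<r} - {k})) n m F"
    by (intro factorizes_cardI[of _ n U _ m V]) (use U_nonneg V_nonneg in auto)
  with minimal[of "r - 1"] k show False
    by simp
qed

text \<open>Adding \<open>c\<close> times row \<open>k\<close> of \<open>V\<close> to row
  \<open>l\<close> would absorb column \<open>k\<close> of \<open>U\<close> into column
  \<open>l\<close> and save the inner index \<open>k\<close>, against minimality.\<close>

lemma U_columns_not_proportional:
  assumes k: "k < r" "l < r" "k \<noteq> l"
    and c: "c \<ge> 0" and eq: "\<And>i. i < n \<Longrightarrow> U i k = c * U i l"
  shows False
proof -
  define V' where "V' q j = (if q = l then V l j + c * V k j else V q j)" for q j
  have "F i j = (\<Sum>q\<in>{..<r} - {k}. U i q * V' q j)" if "i < n" "j < m" for i j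
  proof -
    have "F i j = U i k * V k j + (U i l * V l j + (\<Sum>q\<in>{..<r} - {k} - {l}. U i q * V q j))"
      unfolding F_eq[OF that] using k by (simp add: sum.remove[of _ k] sum.remove[of _ l])
    also have "(\<Sum>q\<in>{..<r} - {k} - {l}. U i q * V q j) = (\<Sum>q\<in>{..<r} - {k} - {l}. U i q * V' q j)"
      by (intro sum.cong) (auto simp: V'_def)
    also have "U i k * V k j + (U i l * V l j + (\<Sum>q\<in>{..<r} - {k} - {l}. U i q * V' q j))
      = U i l * V' l j + (\<Sum>q\<in>{..<r} - {k} - {l}. U i q * V' q j)"
      using eq[OF that(1)] by (simp add: V'_def algebra_simps)
    also have "\<dots> = (\<Sum>q\<in>{..<r} - {k}. U i q * V' q j)"
      using k by (simp add: sum.remove[of _ l])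
    finally show ?thesis .
  qed
  then have "factorizes {0..} (card ({..<r} - {k})) n m F"
    by (intro factorizes_cardI[of _ n U _ m V']) (use U_nonneg V_nonneg c k in \<open>auto simp: V'_def\<close>)
  with minimal[of "r - 1"] k show False
    by simp
qed

lemma U_column_nonzero:
  assumes "k < r"
  shows "\<exists>i<n. U i k > 0"
  using minimal_factorization.V_row_nonzero[OF transposed assms] .

text \<open>Pure columns fix the scale of \<open>U\<close>, which becomes the 0-1 matrix
  \<open>a\<close>. A weight other than 0 and 1 in column \<open>j\<close> of the rescaled
  \<open>V\<close> restricts the rows: if two weights are positive there, two columns of
  \<open>U\<close> become proportional, which minimality forbids; if three are, few distinct rows
  remain.\<close>

lemma pure_columns_imp_binary:
  assumes r: "r \<le> 3"
    and pure: "\<And>k. k < r \<Longrightarrow> \<exists>j<m. V k j > 0 \<and> (\<forall>l<r. l \<noteq> k \<longrightarrow> V l j = 0)"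
  shows "factorizes {0, 1} r n m F"
proof -
  obtain p where p: "\<And>k. k < r \<Longrightarrow> p k < m" "\<And>k. k < r \<Longrightarrow> V k (p k) > 0"
    "\<And>k l. k < r \<Longrightarrow> l < r \<Longrightarrow> l \<noteq> k \<Longrightarrow> V l (p k) = 0"
    using pure by metis
  \<comment> \<open>Scaling by the pure entry makes column \<open>k\<close> of \<open>a\<close>
    equal to column \<open>p k\<close> of \<open>F\<close>, hence 0-1.\<close>
  define a where "a i k = U i k * V k (p k)" for i k
  define w where "w k j = V k j / V k (p k)" for k j
  have "F i (p k) = a i k" if "i < n" "k < r" for i k
  proof -
    have "F i (p k) = (\<Sum>l<r. if l = k then a i k else 0)"
      unfolding F_eq[OF that(1) p(1)[OF that(2)]]
      by (intro sum.cong) (use p(3)[OF that(2)] in \<open>auto simp: a_def\<close>)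
    then show ?thesis
      using that by simp
  qed
  then have a01: "a i k \<in> {0, 1}" if "i < n" "k < r" for i k
    using zero_one[OF that(1) p(1)[OF that(2)]] that by simp
  have F_aw: "F i j = (\<Sum>k<r. a i k * w k j)" if "i < n" "j < m" for i j
    unfolding F_eq[OF that]
  proof (intro sum.cong refl)
    show "U i k * V k j = a i k * w k j" if "k \<in> {..<r}" for k
      using p(2)[of k] that by (simp add: a_def w_def)
  qed
  have w0: "w k j \<ge> 0" if "k < r" "j < m" for k j
    using V_nonneg[OF that] p(2)[OF that(1)] by (simp add: w_def)
  show ?thesis
  proof (cases "\<forall>k<r. \<forall>j<m. w k j \<in> {0, 1}")
    case True
    then show ?thesis
      unfolding factorizes_def by (intro exI[of _ a] exI[of _ w]) (use a01 F_aw in auto)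
  next
    case False
    then obtain k j where kj: "k < r" "j < m" "w k j \<noteq> 0" "w k j \<noteq> 1"
      by blast
    then have wk: "w k j > 0"
      using w0[of k j] by simp
    \<comment> \<open>A row that uses a positive weight of column \<open>j\<close> has a positive
      entry there, and the only positive entry of \<open>F\<close> is 1.\<close>
    have sum1: "(\<Sum>x<r. a i x * w x j) = 1" if "i < n" "l < r" "w l j > 0" "a i l = 1" for i l
    proof -
      have "a i x * w x j \<ge> 0" if "x < r" for x
        using a01[OF \<open>i < n\<close> that] w0[OF that kj(2)] by auto
      then have "a i l * w l j \<le> (\<Sum>x<r. a i x * w x j)"
        using that by (intro member_le_sum) auto
      then show ?thesis
        using zero_one[OF that(1) kj(2)] F_aw[OF that(1) kj(2)] that by auto
    qed
    \<comment> \<open>\<open>w k j\<close> alone cannot produce the sum 1, since it differs from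
      1.\<close>
    have partner: "\<exists>l<r. l \<noteq> k \<and> w l j > 0 \<and> a i l = 1" if i: "i < n" "a i k = 1" for i
    proof (rule ccontr)
      assume *: "\<not> ?thesis"
      have "a i x * w x j = 0" if "x < r" "x \<noteq> k" for x
        using * a01[OF i(1) that(1)] w0[OF that(1) kj(2)] that by fastforce
      then have "(\<Sum>x<r. a i x * w x j) = (\<Sum>x<r. if x = k then w k j else 0)"
        using i by (intro sum.cong) auto
      with sum1[OF i(1) kj(1) wk i(2)] kj show False
        by simp
    qed
    obtain i0 where i0: "i0 < n" "a i0 k = 1"
      using U_column_nonzero[OF kj(1)] a01 p(2)[OF kj(1)] kj(1) unfolding a_def
      by (metis empty_iff insert_iff mult_pos_pos order_less_irrefl)
    obtain l where l: "l < r" "l \<noteq> k" "w l j > 0" "a i0 l = 1"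
      using partner[OF i0] by blast
    show ?thesis
    proof (cases "\<exists>q<r. q \<noteq> k \<and> q \<noteq> l \<and> w q j > 0")
      case False
      have sum2: "(\<Sum>x<r. a i x * w x j) = a i k * w k j + a i l * w l j" if "i < n" for i
      proof -
        have "(\<Sum>x<r. a i x * w x j) = (\<Sum>x\<in>{k, l}. a i x * w x j)"
          by (intro sum.mono_neutral_right) (use False kj l w0 in \<open>force+\<close>)
        then show ?thesis
          using l by simp
      qed
      \<comment> \<open>A row using \<open>l\<close> but not \<open>k\<close> would force
        \<open>w l j = 1\<close>, leaving no room for \<open>w k j > 0\<close> in row
        \<open>i0\<close>. Hence the two columns of \<open>a\<close> agree, and those of
        \<open>U\<close> are proportional.\<close>
      have same: "a i k = a i l" if "i < n" for i
      proof (cases "a i k = 1")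
        case True
        then show ?thesis
          using partner[OF that True] False by metis
      next
        case ak: False
        have "a i l \<noteq> 1"
        proof
          assume "a i l = 1"
          then have "w l j = 1"
            using sum1[OF that l(1,3)] sum2[OF that] a01[OF that kj(1)] ak by simp
          then show False
            using sum1[OF i0(1) l(1,3)] sum2[OF i0(1)] i0 l(4) wk by simp
        qed
        then show ?thesis
          using a01[OF that kj(1)] a01[OF that l(1)] ak by simp
      qed
      have "U i k = V l (p l) / V k (p k) * U i l" if "i < n" for i
        using same[OF that] p(2)[OF kj(1)] by (simp add: a_def field_simps)
      then show ?thesis
        using U_columns_not_proportional[OF kj(1) l(1) l(2)[symmetric]] p(2)[OF kj(1)] p(2)[OF l(1)]
        by (metis divide_nonneg_nonneg less_imp_le)
    next
      case True
      then obtain q where q: "q < r" "q \<noteq> k" "q \<noteq> l" "w q j > 0"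
        by blast
      have r3: "{..<r} = {k, l, q}"
        by (rule card_seteq[symmetric]) (use r kj l q in auto)
      have nz: "(a i k = 1 \<or> a i l = 1 \<or> a i q = 1) \<and> a i k * w k j + a i l * w l j + a i q * w q j = 1"
        if i: "i < n" "\<exists>j<m. F i j \<noteq> 0" for i
      proof -
        obtain j' where "j' < m" "F i j' \<noteq> 0"
          using i by blast
        then have "(\<Sum>x\<in>{k, l, q}. a i x * w x j') \<noteq> 0"
          using F_aw[OF i(1)] r3 by metis
        then have *: "a i k = 1 \<or> a i l = 1 \<or> a i q = 1"
          using a01[OF i(1) kj(1)] a01[OF i(1) l(1)] a01[OF i(1) q(1)] l(2) q(2,3) by auto
        then have "(\<Sum>x<r. a i x * w x j) = 1"
          using sum1[OF i(1) kj(1) wk] sum1[OF i(1) l(1,3)] sum1[OF i(1) q(1,4)] by blast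
        with * show ?thesis
          unfolding r3 using l(2) q(2,3) by (simp add: algebra_simps)
      qed
      define c :: "nat \<Rightarrow> nat" where "c i = (if a i k = 1 \<and> (a i q = 0 \<or> a i l = 1) then 0
        else if a i l = 1 then 1 else 2)" for i
      \<comment> \<open>The colour classes are chains of subsets of \<open>{k, l, q}\<close>, whereas the supports of the
        rows form an antichain because all weights \<open>w _ j\<close> are positive.\<close>
      show ?thesis
      proof (rule factorizes_few_rows[of n m F "{0, 1, 2}" r c])
        show "card {0, 1, 2 :: nat} \<le> r"
          using arg_cong[OF r3, of card] kj l q by simp
        show "F i j' = F i' j'" if "i < n" "i' < n" "\<exists>j<m. F i j \<noteq> 0" "\<exists>j<m. F i' j \<noteq> 0"
          "c i = c i'" "j' < m" for i i' j'
        proof -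
          have "a i k = a i' k \<and> a i l = a i' l \<and> a i q = a i' q"
            using nz[OF that(1,3)] nz[OF that(2,4)] that(5) wk l(3) q(4)
              a01[OF that(1) kj(1)] a01[OF that(1) l(1)] a01[OF that(1) q(1)]
              a01[OF that(2) kj(1)] a01[OF that(2) l(1)] a01[OF that(2) q(1)]
            by (auto simp: c_def split: if_splits)
          then show ?thesis
            unfolding F_aw[OF that(1,6)] F_aw[OF that(2,6)] r3 by (intro sum.cong) auto
        qed
      qed (use zero_one in \<open>auto simp: c_def\<close>)
    qed
  qed
qed

section \<open>Inner dimension three: from supports of columns to pure rows\<close>

lemma F_three:
  assumes "i < n" "j < m" "{..<r} = {k, l, q}" "k \<noteq> l" "k \<noteq> q" "l \<noteq> q"
  shows "F i j = U i k * V k j + U i l * V l j + U i q * V q j"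
  using F_eq[OF assms(1,2)] assms(3-) by (simp add: algebra_simps)

lemma same_U_imp_same_F:
  assumes "i < n" "i' < n" "j < m" "\<And>k. k < r \<Longrightarrow> U i k = U i' k"
  shows "F i j = F i' j"
  unfolding F_eq[OF assms(1,3)] F_eq[OF assms(2,3)] using assms(4) by (intro sum.cong) auto

text \<open>Nonnegative terms cannot cancel, so one positive term makes the entry positive.\<close>

lemma F_pos:
  assumes "i < n" "j < m" "k < r" "U i k > 0" "V k j > 0"
  shows "F i j = 1"
proof -
  have "U i k * V k j \<le> F i j"
    unfolding F_eq[OF assms(1,2)]
    by (rule member_le_sum) (use U_nonneg[OF assms(1)] V_nonneg[OF _ assms(2)] assms(3) in auto)
  then show ?thesis
    using zero_one[OF assms(1,2)] mult_pos_pos[OF assms(4,5)] by auto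
qed

lemma F_nonzero_imp_U_pos:
  assumes "i < n" "\<exists>j<m. F i j \<noteq> 0" "{..<r} = {k, l, q}"
  shows "U i k > 0 \<or> U i l > 0 \<or> U i q > 0"
proof (rule ccontr)
  assume "\<not> ?thesis"
  then have "U i x = 0" if "x < r" for x
  proof -
    have "x \<in> {k, l, q}"
      using that assms(3) by blast
    with \<open>\<not> (U i k > 0 \<or> U i l > 0 \<or> U i q > 0)\<close> show ?thesis
      using U_nonneg[OF assms(1) that] by auto
  qed
  then show False
    using assms(2) F_eq[OF assms(1)] by auto
qed

text \<open>A nonzero row takes one of the patterns 110, 101, 011, 111 on the three columns and is
  determined by it; the pattern 110 is that of a row supported on \<open>k\<close> alone.\<close>

lemma double_columns_imp_pure_row:
  assumes r3: "{..<r} = {k, l, q}" and dist: "k \<noteq> l" "k \<noteq> q" "l \<noteq> q"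
    and x: "x < m" "V k x > 0" "V l x > 0" "V q x = 0"
    and y: "y < m" "V k y > 0" "V l y = 0" "V q y > 0"
    and z: "z < m" "V k z = 0" "V l z > 0" "V q z > 0"
    and not_binary: "\<not> factorizes {0, 1} r n m F"
  shows "\<exists>i<n. U i k > 0 \<and> (\<forall>l<r. l \<noteq> k \<longrightarrow> U i l = 0)"
proof (rule ccontr)
  assume no_pure: "\<not> ?thesis"
  have lt: "k < r" "l < r" "q < r"
    using r3 by auto
  define c where "c i = (F i x, F i y, F i z)" for i
  have "factorizes {0, 1} r n m F"
  proof (rule factorizes_few_rows[of n m F "{(1, 0, 1), (0, 1, 1), (1, 1, 1)}" r c])
    show "card {(1 :: real, 0 :: real, 1 :: real), (0, 1, 1), (1, 1, 1)} \<le> r"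
      using arg_cong[OF r3, of card] dist by simp
    show "c i \<in> {(1, 0, 1), (0, 1, 1), (1, 1, 1)}" if i: "i < n" "\<exists>j<m. F i j \<noteq> 0" for i
    proof -
      have pos: "U i k > 0 \<or> U i l > 0 \<or> U i q > 0"
        by (rule F_nonzero_imp_U_pos[OF i r3])
      \<comment> \<open>Without a pure row at \<open>k\<close>, every nonzero row is positive at
        \<open>l\<close> or \<open>q\<close>; its value on \<open>z\<close> is then 1, which
        excludes the pattern 110.\<close>
      have "U i k > 0 \<Longrightarrow> \<exists>l<r. l \<noteq> k \<and> U i l \<noteq> 0"
        using no_pure i(1) by blast
      then have "U i k > 0 \<Longrightarrow> U i l > 0 \<or> U i q > 0"
        using r3 U_nonneg[OF i(1)] lt lessThan_iff[of _ r] by (metis insertE less_le singletonD)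
      with pos show ?thesis
        using F_pos[OF i(1) x(1) lt(1) _ x(2)] F_pos[OF i(1) x(1) lt(2) _ x(3)]
          F_pos[OF i(1) y(1) lt(1) _ y(2)] F_pos[OF i(1) y(1) lt(3) _ y(4)]
          F_pos[OF i(1) z(1) lt(2) _ z(3)] F_pos[OF i(1) z(1) lt(3) _ z(4)]
          zero_one[OF i(1) x(1)] zero_one[OF i(1) y(1)]
        by (auto simp: c_def)
    qed
    show "F i j = F i' j" if i: "i < n" "i' < n" and "c i = c i'" and j: "j < m" for i i' j
    proof (rule same_U_imp_same_F[OF i j])
      have eqs: "(U i k - U i' k) * V k x = - (U i l - U i' l) * V l x"
        "(U i k - U i' k) * V k y = - (U i q - U i' q) * V q y"
        "(U i l - U i' l) * V l z = - (U i q - U i' q) * V q z"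
        using \<open>c i = c i'\<close> F_three[OF i(1) x(1) r3 dist] F_three[OF i(2) x(1) r3 dist]
          F_three[OF i(1) y(1) r3 dist] F_three[OF i(2) y(1) r3 dist]
          F_three[OF i(1) z(1) r3 dist] F_three[OF i(2) z(1) r3 dist] x y z
        by (simp_all add: c_def algebra_simps)
      \<comment> \<open>The differences between the two rows at \<open>k\<close>, \<open>l\<close>
        and \<open>q\<close> have pairwise opposite signs, which is possible only if all three
        vanish.\<close>
      have opposite: "sgn a = - sgn b" if "a * s = - b * t" "s > 0" "t > 0" for a b s t :: real
        using arg_cong[OF that(1), of sgn] that(2,3) by (simp add: sgn_mult)
      have "sgn (U i k - U i' k) = 0"
        using opposite[OF eqs(1) x(2,3)] opposite[OF eqs(2) y(2,4)] opposite[OF eqs(3) z(3,4)] by simp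
      then have "U i k = U i' k"
        by (simp add: sgn_0_0)
      moreover from this have "U i l = U i' l" "U i q = U i' q"
        using eqs(1,2) x(3) y(4) by simp_all
      ultimately show "U i s = U i' s" if "s < r" for s
        using that r3 lessThan_iff[of s r] by auto
    qed
  qed (use zero_one in auto)
  with not_binary show False ..
qed

text \<open>A nonzero row is already determined by its values on \<open>x\<close> and \<open>y\<close>.\<close>

lemma two_pure_columns_imp_pure_rows:
  assumes r3: "{..<r} = {k, l, q}" and dist: "k \<noteq> l" "k \<noteq> q" "l \<noteq> q"
    and x: "x < m" "V k x = 0" "V l x > 0" "V q x = 0"
    and y: "y < m" "V k y = 0" "V l y = 0" "V q y > 0"
    and z: "z < m" "V k z > 0" "V l z > 0" "V q z = 0"
    and w: "w < m" "V k w > 0" "V l w = 0" "V q w > 0"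
    and not_binary: "\<not> factorizes {0, 1} r n m F"
  shows "\<exists>i<n. U i k > 0 \<and> U i l = 0 \<and> U i q = 0" "\<exists>i<n. U i l > 0 \<and> U i k = 0 \<and> U i q = 0"
proof -
  have lt: "k < r" "l < r" "q < r"
    using r3 by auto
  have Fx: "F i x = U i l * V l x" and Fy: "F i y = U i q * V q y"
    and Fz: "F i z = U i k * V k z + U i l * V l z" and Fw: "F i w = U i k * V k w + U i q * V q w"
    if "i < n" for i
    using F_three[OF that x(1) r3 dist] F_three[OF that y(1) r3 dist]
      F_three[OF that z(1) r3 dist] F_three[OF that w(1) r3 dist] x y z w by simp_all
  define c where "c i = (F i x, F i y)" for i
  have same: "F i j = F i' j" if i: "i < n" "i' < n" "\<exists>j<m. F i j \<noteq> 0" "\<exists>j<m. F i' j \<noteq> 0"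
    and c: "c i = c i'" and j: "j < m" for i i' j
  proof (rule same_U_imp_same_F[OF i(1,2) j])
    have U: "U i l = U i' l" "U i q = U i' q"
      using c Fx[OF i(1)] Fx[OF i(2)] Fy[OF i(1)] Fy[OF i(2)] x(3) y(4) by (auto simp: c_def)
    \<comment> \<open>The entries at \<open>l\<close> and \<open>q\<close> are fixed by
      \<open>x\<close> and \<open>y\<close>. A row positive at \<open>q\<close> has value 1 on
      \<open>w\<close>, any other nonzero row has value 1 on \<open>z\<close>; that column then
      determines the entry at \<open>k\<close>.\<close>
    have "U i k = U i' k"
    proof (cases "U i q > 0")
      case True
      then have "F i w = 1" "F i' w = 1"
        using F_pos[OF i(1) w(1) lt(3) _ w(4)] F_pos[OF i(2) w(1) lt(3) _ w(4)] U by auto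
      moreover have "F i w = U i k * V k w + U i' q * V q w"
        using Fw[OF i(1)] U by simp
      ultimately have "U i k * V k w = U i' k * V k w"
        using Fw[OF i(2)] by linarith
      then show ?thesis
        using w(2) by simp
    next
      case False
      then have "U i q = 0" "U i' q = 0"
        using U U_nonneg[OF i(1) lt(3)] by auto
      then have "U i k > 0 \<or> U i l > 0" "U i' k > 0 \<or> U i' l > 0"
        using F_nonzero_imp_U_pos[OF i(1,3) r3] F_nonzero_imp_U_pos[OF i(2,4) r3] by auto
      then have "F i z = 1" "F i' z = 1"
        using F_pos[OF i(1) z(1) lt(1) _ z(2)] F_pos[OF i(2) z(1) lt(1) _ z(2)]
          F_pos[OF i(1) z(1) lt(2) _ z(3)] F_pos[OF i(2) z(1) lt(2) _ z(3)] by auto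
      moreover have "F i z = U i k * V k z + U i' l * V l z"
        using Fz[OF i(1)] U by simp
      ultimately have "U i k * V k z = U i' k * V k z"
        using Fz[OF i(2)] by linarith
      then show ?thesis
        using z(2) by simp
    qed
    with U show "U i s = U i' s" if "s < r" for s
      using that r3 lessThan_iff[of s r] by auto
  qed
  \<comment> \<open>All four colours occur, because three colour classes would already give a 0-1
    factorization.\<close>
  have colour: "\<exists>i<n. (\<exists>j<m. F i j \<noteq> 0) \<and> c i = t" if t: "t \<in> {0, 1} \<times> {0, 1}" for t
  proof (rule ccontr)
    assume *: "\<not> ?thesis"
    have "factorizes {0, 1} r n m F"
    proof (rule factorizes_few_rows[of n m F "{0, 1} \<times> {0, 1} - {t}" r c])
      show "card ({0 :: real, 1} \<times> {0 :: real, 1} - {t}) \<le> r"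
        using arg_cong[OF r3, of card] dist t by (simp add: card_Diff_singleton card_cartesian_product)
      show "c i \<in> {0, 1} \<times> {0, 1} - {t}" if "i < n" "\<exists>j<m. F i j \<noteq> 0" for i
        using * that zero_one[OF that(1) x(1)] zero_one[OF that(1) y(1)] by (auto simp: c_def)
      show "F i j \<in> {0, 1}" if "i < n" "j < m" for i j
        by (rule zero_one[OF that])
      show "F i j = F i' j" if "i < n" "i' < n" "\<exists>j<m. F i j \<noteq> 0" "\<exists>j<m. F i' j \<noteq> 0"
        "c i = c i'" "j < m" for i i' j
        by (rule same[OF that])
    qed simp
    with not_binary show False ..
  qed
  have "\<exists>i<n. (\<exists>j<m. F i j \<noteq> 0) \<and> c i = (0, 0)" "\<exists>i<n. (\<exists>j<m. F i j \<noteq> 0) \<and> c i = (1, 0)"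
    by (rule colour, simp)+
  then obtain i i' where i: "i < n" "\<exists>j<m. F i j \<noteq> 0" "c i = (0, 0)" and i': "i' < n" "c i' = (1, 0)"
    by blast
  \<comment> \<open>The row of colour \<open>(0, 0)\<close> is pure at \<open>k\<close>; as it has
    value 1 on both \<open>z\<close> and \<open>w\<close>, the entries \<open>V k z\<close> and
    \<open>V k w\<close> coincide.\<close>
  have Ui: "U i l = 0" "U i q = 0"
    using i(3) Fx[OF i(1)] Fy[OF i(1)] x(3) y(4) by (auto simp: c_def)
  then have Uik: "U i k > 0"
    using F_nonzero_imp_U_pos[OF i(1,2) r3] by auto
  have "F i z = 1" "F i w = 1"
    using F_pos[OF i(1) z(1) lt(1) Uik z(2)] F_pos[OF i(1) w(1) lt(1) Uik w(2)] .
  then have "U i k * V k z = U i k * V k w"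
    using Fz[OF i(1)] Fw[OF i(1)] Ui by simp
  then have zw: "V k z = V k w"
    using Uik by simp
  show "\<exists>i<n. U i k > 0 \<and> U i l = 0 \<and> U i q = 0"
    using i(1) Uik Ui by blast
  have Ul: "U i' l > 0" "U i' q = 0"
    using i'(2) Fx[OF i'(1)] Fy[OF i'(1)] x(3) y(4) U_nonneg[OF i'(1) lt(2)]
    by (auto simp: c_def less_le)
  have "F i' z = 1"
    by (rule F_pos[OF i'(1) z(1) lt(2) Ul(1) z(3)])
  \<comment> \<open>On \<open>z\<close> the index \<open>l\<close> contributes a positive part of
    the value 1, so the term of \<open>k\<close> is less than 1. The same term is the whole 0-1
    entry on \<open>w\<close>, hence it is 0.\<close>
  then have "U i' k * V k w < 1"
    using Fz[OF i'(1)] mult_pos_pos[OF Ul(1) z(3)] zw by simp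
  then have "U i' k * V k w = 0"
    using Fw[OF i'(1)] Ul(2) zero_one[OF i'(1) w(1)] by auto
  then have "U i' k = 0"
    using w(2) by simp
  with i'(1) Ul show "\<exists>i<n. U i l > 0 \<and> U i k = 0 \<and> U i q = 0"
    by blast
qed

lemma pure_rows_imp_binary:
  assumes "r \<le> 3"
    and "\<And>k. k < r \<Longrightarrow> \<exists>i<n. U i k > 0 \<and> (\<forall>l<r. l \<noteq> k \<longrightarrow> U i l = 0)"
  shows "factorizes {0, 1} r n m F"
proof -
  have "factorizes {0, 1} r m n (\<lambda>j i. F i j)"
    by (rule minimal_factorization.pure_columns_imp_binary[OF transposed assms])
  from factorizes_transpose[OF this] show ?thesis .
qed

text \<open>For \<open>r = 3\<close>, an index without a pure column has, by the antichain
  condition, columns supported on exactly it and either other index. Such columns yield pure rows at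
  all three indices, and \<open>pure_rows_imp_binary\<close> applies.\<close>

lemma antichain_imp_binary:
  assumes r: "r \<le> 3"
    and antichain: "\<And>k l. k < r \<Longrightarrow> l < r \<Longrightarrow> k \<noteq> l \<Longrightarrow> \<exists>j<m. V k j > 0 \<and> V l j = 0"
  shows "factorizes {0, 1} r n m F"
proof (rule ccontr)
  assume not_binary: "\<not> ?thesis"
  define pure where "pure k \<longleftrightarrow> (\<exists>j<m. V k j > 0 \<and> (\<forall>l<r. l \<noteq> k \<longrightarrow> V l j = 0))" for k
  define double where "double k l q \<longleftrightarrow> (\<exists>j<m. V k j > 0 \<and> V l j > 0 \<and> V q j = 0)" for k l q
  have V_cases: "V k j = 0 \<or> V k j > 0" if "k < r" "j < m" for k j
    using V_nonneg[OF that] by auto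
  obtain k where k: "k < r" "\<not> pure k"
    using pure_columns_imp_binary[OF r] not_binary unfolding pure_def by blast
  \<comment> \<open>With one or two indices, a nonzero row or the antichain condition already
    supplies a pure column for \<open>k\<close>; hence \<open>r = 3\<close>.\<close>
  have "\<exists>j<m. V k j > 0 \<and> (\<forall>l<r. l \<noteq> k \<longrightarrow> V l j = 0)" if "r < 3"
  proof (cases "\<exists>l<r. l \<noteq> k")
    case True
    then obtain l where l: "l < r" "l \<noteq> k"
      by blast
    then have "{..<r} = {k, l}"
      by (intro card_seteq[symmetric]) (use k that in auto)
    then show ?thesis
      using antichain[OF k(1) l(1)] l lessThan_iff[of _ r] by (metis insertE singletonD)
  next
    case False
    then show ?thesis
      using V_row_nonzero[OF k(1)] by blast
  qed
  with k have "\<not> r < 3"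
    unfolding pure_def by blast
  with r have "r = 3"
    by simp
  obtain l q where dist: "k \<noteq> l" "k \<noteq> q" "l \<noteq> q" and r3: "{..<r} = {k, l, q}"
  proof -
    have "card ({..<r} - {k}) = 2"
      using k(1) \<open>r = 3\<close> by simp
    then obtain l q where "{..<r} - {k} = {l, q}" "l \<noteq> q"
      by (auto simp: card_2_iff)
    then show ?thesis
      using that[of l q] k(1) by auto
  qed
  have dbl: "double a b c" if abc: "a < r" "\<not> pure a" "{..<r} = {a, b, c}" "a \<noteq> b" "a \<noteq> c" "b \<noteq> c" for a b c
  proof -
    have lt: "b < r" "c < r"
      using abc(3) by auto
    obtain j where j: "j < m" "V a j > 0" "V c j = 0"
      using antichain[OF abc(1) lt(2) abc(5)] by blast
    moreover have "V b j \<noteq> 0"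
    proof
      assume "V b j = 0"
      then have "pure a"
        unfolding pure_def using j abc(3) lessThan_iff[of _ r] by (metis insertE singletonD)
      with abc(2) show False ..
    qed
    ultimately show ?thesis
      unfolding double_def using V_cases[OF lt(1) j(1)] by blast
  qed
  have lt: "l < r" "q < r"
    using r3 by auto
  have perms: "{..<r} = {k, q, l}" "{..<r} = {l, k, q}" "{..<r} = {l, q, k}"
    "{..<r} = {q, k, l}" "{..<r} = {q, l, k}"
    using r3 by auto
  have dk: "double k l q" "double k q l"
    using dbl[OF k r3] dbl[OF k perms(1)] dist by auto
  have rows: "(\<exists>i<n. U i k > 0 \<and> (\<forall>l<r. l \<noteq> k \<longrightarrow> U i l = 0))
    \<and> (\<exists>i<n. U i l > 0 \<and> (\<forall>k<r. k \<noteq> l \<longrightarrow> U i k = 0))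
    \<and> (\<exists>i<n. U i q > 0 \<and> (\<forall>k<r. k \<noteq> q \<longrightarrow> U i k = 0))"
  proof (cases "pure l \<and> pure q")
    case True
    then obtain x y where x: "x < m" "V k x = 0" "V l x > 0" "V q x = 0"
      and y: "y < m" "V k y = 0" "V l y = 0" "V q y > 0"
      unfolding pure_def using k(1) lt dist by metis
    obtain z where z: "z < m" "V k z > 0" "V l z > 0" "V q z = 0"
      using dk(1) unfolding double_def by blast
    obtain w where w: "w < m" "V k w > 0" "V l w = 0" "V q w > 0"
      using dk(2) unfolding double_def by blast
    note 1 = two_pure_columns_imp_pure_rows[OF r3 dist x y z w not_binary]
    \<comment> \<open>Exchanging \<open>l\<close> with \<open>q\<close>, \<open>x\<close> with
      \<open>y\<close> and \<open>z\<close> with \<open>w\<close> gives the pure row at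
      \<open>q\<close>.\<close>
    note 2 = two_pure_columns_imp_pure_rows(2)[OF perms(1) dist(2,1) dist(3)[symmetric]
      y(1,2,4,3) x(1,2,4,3) w(1,2,4,3) z(1,2,4,3) not_binary]
    have all: "(\<forall>s<r. Q s) \<longleftrightarrow> Q k \<and> Q l \<and> Q q" for Q
      using r3 by (metis insertCI insertE lessThan_iff singletonD)
    show ?thesis
      unfolding all using 1 2 dist by blast
  next
    case False
    \<comment> \<open>A second index without a pure column makes the remaining pair a support too.
      All three pairs are now supports, and each index in turn takes the role of
      \<open>k\<close>.\<close>
    then have "double l q k"
      using dbl[OF lt(1) _ perms(3)] dbl[OF lt(2) _ perms(5)] dist unfolding double_def by auto
    then obtain z where z: "z < m" "V k z = 0" "V l z > 0" "V q z > 0"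
      unfolding double_def by blast
    obtain x where x: "x < m" "V k x > 0" "V l x > 0" "V q x = 0"
      using dk(1) unfolding double_def by blast
    obtain y where y: "y < m" "V k y > 0" "V l y = 0" "V q y > 0"
      using dk(2) unfolding double_def by blast
    show ?thesis
      using double_columns_imp_pure_row[OF r3 dist x y z not_binary]
        double_columns_imp_pure_row[OF perms(2) dist(1)[symmetric] dist(3) dist(2)
          x(1,3,2,4) z(1,3,2,4) y(1,3,2,4) not_binary]
        double_columns_imp_pure_row[OF perms(4) dist(2)[symmetric] dist(3)[symmetric] dist(1)
          y(1,4,2,3) z(1,4,2,3) x(1,4,2,3) not_binary]
      by blast
  qed
  have "\<exists>i<n. U i s > 0 \<and> (\<forall>l<r. l \<noteq> s \<longrightarrow> U i l = 0)" if "s < r" for s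
    using that rows r3 lessThan_iff[of s r] by auto
  then show False
    using pure_rows_imp_binary[OF r] not_binary by blast
qed

end

section \<open>Extremal factorizations, and equality of the ranks up to three\<close>

lemma ex_antichain_factorization:
  assumes zero_one: "\<And>i j. i < n \<Longrightarrow> j < m \<Longrightarrow> F i j \<in> {0, 1}"
    and fact: "factorizes {0..} r n m F"
    and minimal: "\<And>s. s < r \<Longrightarrow> \<not> factorizes {0..} s n m F"
  shows "\<exists>U V. minimal_factorization n m r F U V
    \<and> (\<forall>k<r. \<forall>l<r. k \<noteq> l \<longrightarrow> (\<exists>j<m. V k j > 0 \<and> V l j = 0))"
proof -
  \<comment> \<open>The factorization is chosen with the most zeros in \<open>V\<close>; their
    number is at most \<open>r * m\<close>.\<close>
  define Z where "Z V = {(k, j). k < r \<and> j < m \<and> V k j = 0}" for V :: "nat \<Rightarrow> nat \<Rightarrow> real"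
  have Z_subset: "Z V \<subseteq> {..<r} \<times> {..<m}" for V
    by (auto simp: Z_def)
  obtain U0 V0 where UV0: "\<forall>i<n. \<forall>k<r. U0 i k \<in> {0..}" "\<forall>k<r. \<forall>j<m. V0 k j \<in> {0..}"
    "\<forall>i<n. \<forall>j<m. F i j = (\<Sum>k<r. U0 i k * V0 k j)"
    using fact unfolding factorizes_def by blast
  have "minimal_factorization n m r F U0 V0"
    by unfold_locales (use UV0 zero_one minimal in auto)
  then have p0: "minimal_factorization n m r F (fst (U0, V0)) (snd (U0, V0))"
    by simp
  have bounded: "\<forall>p. minimal_factorization n m r F (fst p) (snd p) \<longrightarrow> card (Z (snd p)) < Suc (r * m)"
    using card_mono[OF _ Z_subset] by (simp add: card_cartesian_product less_Suc_eq_le)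
  obtain p where p: "minimal_factorization n m r F (fst p) (snd p)"
    and max: "\<And>p'. minimal_factorization n m r F (fst p') (snd p') \<Longrightarrow> card (Z (snd p')) \<le> card (Z (snd p))"
    using ex_has_greatest_nat[of "\<lambda>p. minimal_factorization n m r F (fst p) (snd p)", OF p0 bounded]
    by blast
  define U V where "U = fst p" and "V = snd p"
  interpret minimal_factorization n m r F U V
    using p by (simp add: U_def V_def)
  have "\<exists>j<m. V k j > 0 \<and> V l j = 0" if kl: "k < r" "l < r" "k \<noteq> l" for k l
  proof (rule ccontr)
    assume no: "\<not> ?thesis"
    define C where "C = {j. j < m \<and> V k j > 0}"
    have C: "finite C" "C \<noteq> {}"
      using V_row_nonzero[OF kl(1)] by (auto simp: C_def)
    \<comment> \<open>The largest multiple of row \<open>k\<close> that row \<open>l\<close> can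
      lose while staying nonnegative; where the minimum is attained, a new zero appears.\<close>
    define t where "t = Min ((\<lambda>j. V l j / V k j) ` C)"
    have t_le: "t \<le> V l j / V k j" if "j \<in> C" for j
      using C that by (simp add: t_def)
    have "t \<in> (\<lambda>j. V l j / V k j) ` C"
      unfolding t_def using C by (intro Min_in) auto
    then obtain j0 where j0: "j0 \<in> C" "t = V l j0 / V k j0"
      by blast
    have j0': "j0 < m" "V k j0 > 0" "V l j0 \<noteq> 0"
      using j0(1) no by (auto simp: C_def)
    have t0: "t \<ge> 0"
      using j0 V_nonneg[OF kl(2) j0'(1)] j0'(2) by simp
    \<comment> \<open>Adding \<open>t\<close> times column \<open>l\<close> of \<open>U\<close> to
      column \<open>k\<close> compensates the subtraction, so the product is unchanged.\<close>
    define U' where "U' i s = (if s = k then U i k + t * U i l else U i s)" for i s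
    define V' where "V' s j = (if s = l then V l j - t * V k j else V s j)" for s j
    have "t * V k j \<le> V l j" if "j < m" for j
    proof (cases "j \<in> C")
      case True
      then show ?thesis
        using t_le[OF True] by (simp add: C_def field_simps)
    next
      case False
      then show ?thesis
        using V_nonneg[OF kl(1) that] V_nonneg[OF kl(2) that] that by (simp add: C_def)
    qed
    then have V'_nonneg: "0 \<le> V' s j" if "s < r" "j < m" for s j
      using V_nonneg[OF that] that by (auto simp: V'_def)
    have sums: "(\<Sum>s<r. U i s * V s j) = (\<Sum>s<r. U' i s * V' s j)" for i j
    proof -
      have split: "(\<Sum>s<r. f s) = f k + (f l + (\<Sum>s\<in>{..<r} - {k} - {l}. f s))" for f :: "nat \<Rightarrow> real"
        using kl by (simp add: sum.remove[of _ k] sum.remove[of _ l])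
      have "(\<Sum>s\<in>{..<r} - {k} - {l}. U i s * V s j) = (\<Sum>s\<in>{..<r} - {k} - {l}. U' i s * V' s j)"
        by (intro sum.cong) (auto simp: U'_def V'_def)
      then show ?thesis
        unfolding split using kl(3) by (simp add: U'_def V'_def algebra_simps)
    qed
    have "minimal_factorization n m r F U' V'"
    proof
      show "0 \<le> U' i s" if "i < n" "s < r" for i s
        using U_nonneg[OF that(1)] that kl t0 by (simp add: U'_def)
      show "F i j = (\<Sum>s<r. U' i s * V' s j)" if "i < n" "j < m" for i j
        using F_eq[OF that] sums by simp
    qed (use zero_one minimal V'_nonneg in auto)
    then have "card (Z V') \<le> card (Z V)"
      using max[of "(U', V')"] by (simp add: V_def)
    moreover have "card (Z V) < card (Z V')"
    proof (rule psubset_card_mono)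
      show "finite (Z V')"
        by (rule finite_subset[OF Z_subset]) simp
      \<comment> \<open>Old zeros of row \<open>l\<close> survive, because row \<open>k\<close>
        vanishes there as well.\<close>
      have "V k j = 0" if "V l j = 0" "j < m" for j
        using no that V_nonneg[OF kl(1) that(2)] by (meson antisym_conv2 not_less)
      then have "Z V \<subseteq> Z V'"
        by (auto simp: Z_def V'_def)
      moreover have "(l, j0) \<in> Z V' - Z V"
        using j0 j0' kl by (simp add: Z_def V'_def)
      ultimately show "Z V \<subset> Z V'"
        by blast
    qed
    ultimately show False
      by simp
  qed
  then show ?thesis
    using minimal_factorization_axioms by blast
qed

lemma nonneg_rank_le_binary_rank:
  assumes "zero_one_mat M"
  shows "nonneg_rank M \<le> binary_rank M"
proof (rule nonneg_rank_le)
  show "factorizes {0..} (binary_rank M) (dim_row M) (dim_col M) (\<lambda>i j. M $$ (i, j))"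
    using factorizes_binary_rank[OF assms] by (rule factorizes_mono) simp
qed

lemma binary_rank_eq_nonneg_rank:
  assumes M: "zero_one_mat M" and r: "nonneg_rank M \<le> 3"
  shows "nonneg_rank M = binary_rank M"
proof (rule antisym[OF nonneg_rank_le_binary_rank[OF M] binary_rank_le])
  define F where "F = (\<lambda>i j. M $$ (i, j))"
  have zero_one: "F i j \<in> {0, 1}" if "i < dim_row M" "j < dim_col M" for i j
    using M elements_matI[OF carrier_matI[OF refl refl] that refl]
    unfolding zero_one_mat_def F_def by blast
  have fact: "factorizes {0..} (nonneg_rank M) (dim_row M) (dim_col M) F"
    unfolding F_def by (rule factorizes_nonneg_rank[OF M])
  have minimal: "\<not> factorizes {0..} s (dim_row M) (dim_col M) F" if "s < nonneg_rank M" for s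
    using that nonneg_rank_le[of s M] unfolding F_def by auto
  obtain U V where
    min: "minimal_factorization (dim_row M) (dim_col M) (nonneg_rank M) F U V" and
    antichain: "\<forall>k<nonneg_rank M. \<forall>l<nonneg_rank M. k \<noteq> l \<longrightarrow> (\<exists>j<dim_col M. V k j > 0 \<and> V l j = 0)"
    using ex_antichain_factorization[OF zero_one fact minimal] by blast
  have "factorizes {0, 1} (nonneg_rank M) (dim_row M) (dim_col M) F"
  proof (rule minimal_factorization.antichain_imp_binary[OF min r])
    show "\<exists>j<dim_col M. V k j > 0 \<and> V l j = 0"
      if "k < nonneg_rank M" "l < nonneg_rank M" "k \<noteq> l" for k l
      using antichain that by blast
  qed
  then show "factorizes {0, 1} (nonneg_rank M) (dim_row M) (dim_col M) (\<lambda>i j. M $$ (i, j))"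
    unfolding F_def .
qed

subsection \<open>Block decompositions\<close>

definition decomposes :: "'a set set \<Rightarrow> 'a set \<Rightarrow> bool" where
  "decomposes \<B> R \<longleftrightarrow> (\<exists>T\<subseteq>\<B>. pairwise disjnt T \<and> \<Union>T = R)"

text \<open>The blocks are the supports of the rows of \<open>V\<close>. An entry of the product
  counts the selected blocks containing its column, so 0-1 entries make the selected blocks
  disjoint. Equal supports merge, hence only \<open>card \<B> \<le> r\<close>.\<close>

lemma factorizes_imp_decomposes:
  assumes fact: "factorizes {0, 1} r n m (\<lambda>i j. if j \<in> R i then 1 else 0)"
    and R: "\<And>i. i < n \<Longrightarrow> R i \<subseteq> {..<m}"
  shows "\<exists>\<B>. finite \<B> \<and> card \<B> \<le> r \<and> (\<forall>i<n. decomposes \<B> (R i))"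
proof -
  obtain U V where U: "\<forall>i<n. \<forall>k<r. U i k \<in> {0, 1 :: real}"
    and V: "\<forall>k<r. \<forall>j<m. V k j \<in> {0, 1 :: real}"
    and F: "\<forall>i<n. \<forall>j<m. (if j \<in> R i then 1 else 0) = (\<Sum>k<r. U i k * V k j)"
    using fact unfolding factorizes_def by blast
  define B where "B k = {j. j < m \<and> V k j = 1}" for k
  have count: "card {k. k < r \<and> U i k = 1 \<and> j \<in> B k} = (if j \<in> R i then 1 else 0)"
    if ij: "i < n" "j < m" for i j
  proof -
    have "(\<Sum>k<r. U i k * V k j) = (\<Sum>k<r. if U i k = 1 \<and> j \<in> B k then 1 else 0)"
    proof (intro sum.cong refl)
      show "U i k * V k j = (if U i k = 1 \<and> j \<in> B k then 1 else 0)" if "k \<in> {..<r}" for k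
      proof -
        have "U i k = 0 \<or> U i k = 1" "V k j = 0 \<or> V k j = 1"
          using U V ij that by blast+
        then show ?thesis
          using ij by (auto simp: B_def)
      qed
    qed
    also have "\<dots> = real (card {k. k < r \<and> U i k = 1 \<and> j \<in> B k})"
      by (simp add: sum.If_cases Int_def)
    finally have "real (card {k. k < r \<and> U i k = 1 \<and> j \<in> B k}) = (if j \<in> R i then 1 else 0)"
      using F ij by simp
    then show ?thesis
      by (simp split: if_splits)
  qed
  have "decomposes (B ` {..<r}) (R i)" if i: "i < n" for i
    unfolding decomposes_def
  proof (intro exI conjI)
    define T where "T = B ` {k. k < r \<and> U i k = 1}"
    show "T \<subseteq> B ` {..<r}"
      by (auto simp: T_def)
    show "pairwise disjnt T"
    proof (rule pairwiseI)
      fix X Y assume "X \<in> T" "Y \<in> T" "X \<noteq> Y"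
      then obtain k l where kl: "k < r" "U i k = 1" "X = B k" "l < r" "U i l = 1" "Y = B l" "k \<noteq> l"
        by (auto simp: T_def)
      show "disjnt X Y"
      proof (rule ccontr)
        assume "\<not> disjnt X Y"
        then obtain j where j: "j \<in> B k" "j \<in> B l"
          using kl by (auto simp: disjnt_def)
        then have "j < m"
          by (simp add: B_def)
        have "card {k, l} \<le> card {k. k < r \<and> U i k = 1 \<and> j \<in> B k}"
          by (intro card_mono) (use kl j in auto)
        then show False
          using count[OF i \<open>j < m\<close>] kl by (simp split: if_splits)
      qed
    qed
    show "\<Union>T = R i"
    proof (intro equalityI subsetI)
      fix j assume "j \<in> \<Union>T"
      then obtain k where k: "k < r" "U i k = 1" "j \<in> B k"
        by (auto simp: T_def)
      then have "j < m" "card {k. k < r \<and> U i k = 1 \<and> j \<in> B k} \<noteq> 0"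
        by (auto simp: B_def)
      then show "j \<in> R i"
        using count[OF i] by (simp split: if_splits)
    next
      fix j assume j: "j \<in> R i"
      then have "card {k. k < r \<and> U i k = 1 \<and> j \<in> B k} = 1"
        using count[OF i, of j] R[OF i] by auto
      then have "{k. k < r \<and> U i k = 1 \<and> j \<in> B k} \<noteq> {}"
        by (metis card.empty zero_neq_one)
      then show "j \<in> \<Union>T"
        by (auto simp: T_def)
    qed
  qed
  moreover have "card (B ` {..<r}) \<le> r"
    using card_image_le[of "{..<r}" B] by simp
  ultimately show ?thesis
    by (intro exI[of _ "B ` {..<r}"]) simp
qed

section \<open>Counting the blocks that meet a group of points\<close>

definition purely_covered :: "'a set set \<Rightarrow> 'a set \<Rightarrow> bool" where
  "purely_covered \<B> C \<longleftrightarrow> (\<forall>c\<in>C. \<exists>B\<in>\<B>. c \<in> B \<and> B \<subseteq> C)"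

text \<open>\<open>G\<close> is a group of points and \<open>D\<close> holds the additional columns:
  these blocks have points, all in \<open>G\<close>. Disjoint groups thus have disjoint families,
  which can be counted separately.\<close>

definition group_blocks :: "'a set set \<Rightarrow> 'a set \<Rightarrow> 'a set \<Rightarrow> 'a set set" where
  "group_blocks \<B> G D = {B \<in> \<B>. B \<inter> G \<noteq> {} \<and> B \<subseteq> G \<union> D}"

text \<open>If every singleton occurs, there are \<open>card G\<close> of them. Otherwise a point
  \<open>p0\<close> without singleton occurs in all its pairs, a star of \<open>card G - 1\<close>
  sets, and a pair away from \<open>p0\<close> contributes another set. If some \<open>{x}\<close>
  occurs too, that further set can be chosen different from \<open>{x}\<close>, which makes one
  more.\<close>

lemma card_pair_traces:
  assumes fin: "finite \<T>" "finite G" and G3: "3 \<le> card G"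
    and pairs: "\<And>p q. p \<in> G \<Longrightarrow> q \<in> G \<Longrightarrow> p \<noteq> q \<Longrightarrow> {p, q} \<in> \<T> \<or> {p} \<in> \<T> \<and> {q} \<in> \<T>"
  shows "card G \<le> card \<T>"
    and "x \<in> G \<Longrightarrow> {x} \<in> \<T> \<Longrightarrow> p0 \<in> G \<Longrightarrow> {p0} \<notin> \<T> \<Longrightarrow> card G < card \<T>"
proof -
  have star: "card (insert E ((\<lambda>q. {p0, q}) ` (G - {p0}))) = card G"
    "insert E ((\<lambda>q. {p0, q}) ` (G - {p0})) \<subseteq> \<T>"
    if p0: "p0 \<in> G" "{p0} \<notin> \<T>" and E: "E \<in> \<T>" "p0 \<notin> E" for p0 E
  proof -
    have "inj_on (\<lambda>q. {p0, q}) (G - {p0})"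
      by (rule inj_onI) (auto simp: doubleton_eq_iff)
    then have "card ((\<lambda>q. {p0, q}) ` (G - {p0})) = card G - 1"
      using p0 fin by (simp add: card_image)
    moreover have "E \<notin> (\<lambda>q. {p0, q}) ` (G - {p0})"
      using E by auto
    ultimately show "card (insert E ((\<lambda>q. {p0, q}) ` (G - {p0}))) = card G"
      using fin G3 by simp
    show "insert E ((\<lambda>q. {p0, q}) ` (G - {p0})) \<subseteq> \<T>"
      using pairs[OF p0(1)] p0(2) E(1) by auto
  qed
  show "card G \<le> card \<T>"
  proof (cases "\<forall>p\<in>G. {p} \<in> \<T>")
    case True
    then show ?thesis
      using fin card_inj_on_le[of "\<lambda>p. {p}" G \<T>] by auto
  next
    case False
    then obtain p0 where p0: "p0 \<in> G" "{p0} \<notin> \<T>"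
      by blast
    obtain q1 q2 where q: "q1 \<in> G - {p0}" "q2 \<in> G - {p0}" "q1 \<noteq> q2"
    proof -
      have "2 \<le> card (G - {p0})"
        using p0 fin G3 by simp
      then show ?thesis
        using that by (metis card_le_Suc0_iff_eq finite_Diff fin(2) not_less_eq_eq numeral_2_eq_2)
    qed
    then obtain E where "E \<in> \<T>" "p0 \<notin> E"
      using pairs[of q1 q2] by auto
    from star[OF p0 this] show ?thesis
      using card_mono[OF fin(1)] by metis
  qed
  show "card G < card \<T>" if x: "x \<in> G" "{x} \<in> \<T>" and p0: "p0 \<in> G" "{p0} \<notin> \<T>"
  proof -
    have "p0 \<noteq> x"
      using x p0 by auto
    then have "card (G - {p0, x}) \<noteq> 0"
      using fin G3 x p0 by (simp add: card_Diff_subset)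
    then obtain y where y: "y \<in> G" "y \<noteq> p0" "y \<noteq> x"
      by (metis Diff_iff card.empty ex_in_conv insert_iff)
    obtain E where E: "E \<in> \<T>" "p0 \<notin> E" "E \<noteq> {x}"
      using pairs[OF x(1) y(1)] y \<open>p0 \<noteq> x\<close> by (metis doubleton_eq_iff empty_iff insert_iff)
    have "{x} \<notin> insert E ((\<lambda>q. {p0, q}) ` (G - {p0}))"
      using E \<open>p0 \<noteq> x\<close> by auto
    then have "insert E ((\<lambda>q. {p0, q}) ` (G - {p0})) \<subset> \<T>"
      using star(2)[OF p0 E(1,2)] x(2) by blast
    then show ?thesis
      using star(1)[OF p0 E(1,2)] psubset_card_mono[OF fin(1)] by metis
  qed
qed

text \<open>The blocks covering \<open>p\<close> and \<open>q\<close> stay inside the row, so they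
  belong to the group and meet \<open>G\<close> only within \<open>{p, q}\<close>.\<close>

lemma group_blocks_pair_trace:
  assumes dec: "decomposes \<B> ({p, q} \<union> C)" and pq: "p \<in> G" "q \<in> G"
    and D: "G \<inter> D = {}" "C \<subseteq> D"
  defines "\<T> \<equiv> (\<lambda>B. B \<inter> G) ` group_blocks \<B> G D"
  shows "{p, q} \<in> \<T> \<or> {p} \<in> \<T> \<and> {q} \<in> \<T>"
proof -
  obtain T where T: "T \<subseteq> \<B>" "\<Union>T = {p, q} \<union> C"
    using dec unfolding decomposes_def by blast
  have trace: "B \<inter> G \<in> \<T>" if "B \<in> T" "x \<in> B" "x \<in> G" for B x
  proof -
    have "B \<in> \<B>" "B \<subseteq> {p, q} \<union> C"
      using that T by blast+
    then have "B \<in> \<B>" "B \<subseteq> G \<union> D" "B \<inter> G \<noteq> {}"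
      using that pq D by blast+
    then show ?thesis
      unfolding \<T>_def group_blocks_def by blast
  qed
  have sub: "B \<inter> G \<subseteq> {p, q}" if "B \<in> T" for B
    using that T(2) D by blast
  obtain B B' where B: "B \<in> T" "p \<in> B" "B' \<in> T" "q \<in> B'"
    using T(2) by blast
  have "B \<inter> G = {p} \<or> B \<inter> G = {p, q}" "B' \<inter> G = {q} \<or> B' \<inter> G = {p, q}"
    using sub[OF B(1)] sub[OF B(3)] B pq by blast+
  then show ?thesis
    using trace[OF B(1,2) pq(1)] trace[OF B(3,4) pq(2)] by auto
qed

text \<open>If each point of \<open>G\<close> has just one block, then a column \<open>c\<close> covered only by
  such blocks would have to lie in exactly one of the two blocks of every pair of points, which is
  impossible for three points.\<close>

lemma ex_pure_block:
  assumes fin: "finite \<B>" "finite G" and G3: "3 \<le> card G"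
    and D: "G \<inter> D = {}" "C \<subseteq> D"
    and dec: "\<And>p q. p \<in> G \<Longrightarrow> q \<in> G \<Longrightarrow> p \<noteq> q \<Longrightarrow> decomposes \<B> ({p, q} \<union> C)"
    and few: "card (group_blocks \<B> G D) \<le> card G"
    and singles: "\<And>p. p \<in> G \<Longrightarrow> {p} \<in> (\<lambda>B. B \<inter> G) ` group_blocks \<B> G D"
    and c: "c \<in> C"
  shows "\<exists>B\<in>\<B>. c \<in> B \<and> B \<subseteq> C"
proof (rule ccontr)
  assume no_pure: "\<not> ?thesis"
  define N where "N = group_blocks \<B> G D"
  define tr where "tr B = B \<inter> G" for B
  have finN: "finite N"
    using fin by (simp add: N_def group_blocks_def)
  have sub: "(\<lambda>p. {p}) ` G \<subseteq> tr ` N"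
    using singles by (auto simp: N_def tr_def[abs_def])
  have "card ((\<lambda>p. {p}) ` G) = card G"
    by (simp add: card_image)
  moreover have "card (tr ` N) \<le> card N"
    by (rule card_image_le[OF finN])
  \<comment> \<open>The singletons are \<open>card G\<close> traces of at most \<open>card G\<close>
    blocks, so they are all the traces and each comes from just one block.\<close>
  ultimately have eq: "(\<lambda>p. {p}) ` G = tr ` N" "card (tr ` N) = card N"
    using few card_seteq[OF _ sub] card_mono[OF _ sub] finN by (auto simp: N_def)
  then have inj: "inj_on tr N"
    using finN by (intro eq_card_imp_inj_on)
  have "\<exists>B. B \<in> N \<and> tr B = {p}" if "p \<in> G" for p
    using singles[OF that] by (auto simp: N_def tr_def)
  then obtain b where b: "\<And>p. p \<in> G \<Longrightarrow> b p \<in> N" "\<And>p. p \<in> G \<Longrightarrow> tr (b p) = {p}"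
    by metis
  have unique: "B = b p" if "B \<in> \<B>" "B \<subseteq> G \<union> D" "p \<in> B" "p \<in> G" for B p
  proof -
    have \<open>B \<in> N\<close>
      using that unfolding N_def group_blocks_def by blast
    then have "tr B \<in> (\<lambda>p. {p}) ` G"
      using eq by auto
    then obtain p' where "tr B = {p'}"
      by auto
    moreover have "p \<in> tr B"
      using that by (simp add: tr_def)
    ultimately have "tr B = {p}"
      by simp
    with \<open>B \<in> N\<close> show ?thesis
      using inj b[OF \<open>p \<in> G\<close>] by (auto dest: inj_onD)
  qed
  \<comment> \<open>The row of \<open>p\<close> and \<open>q\<close> uses the disjoint blocks
    \<open>b p\<close> and \<open>b q\<close>. Its block through \<open>c\<close> is not inside
    \<open>C\<close>, so it contains \<open>p\<close> or \<open>q\<close> and is one of these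
    two.\<close>
  have exactly_one: "c \<in> b p \<longleftrightarrow> c \<notin> b q" if pq: "p \<in> G" "q \<in> G" "p \<noteq> q" for p q
  proof -
    obtain T where T: "T \<subseteq> \<B>" "pairwise disjnt T" "\<Union>T = {p, q} \<union> C"
      using dec[OF pq] unfolding decomposes_def by blast
    have TD: "B \<subseteq> G \<union> D" "B \<in> \<B>" if "B \<in> T" for B
    proof -
      have "B \<subseteq> {p, q} \<union> C"
        using that T(3) by blast
      then show "B \<subseteq> G \<union> D"
        using pq D(2) by blast
      show "B \<in> \<B>"
        using that T(1) by blast
    qed
    have mem: "b x \<in> T" if x: "x \<in> {p, q}" for x
    proof -
      have "x \<in> G"
        using x pq(1,2) by blast
      moreover obtain B where B: "B \<in> T" "x \<in> B"
        using x T(3) by blast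
      ultimately have "B = b x"
        by (intro unique[OF TD(2,1)[OF B(1)]])
      with B show ?thesis
        by simp
    qed
    obtain B where B: "B \<in> T" "c \<in> B"
      using c T(3) by blast
    then have "\<not> B \<subseteq> C"
      using no_pure TD(2) by blast
    then obtain x where "x \<in> B" "x \<in> {p, q}"
      using B(1) T(3) by blast
    moreover from this have "x \<in> G"
      using pq(1,2) by blast
    ultimately have "B = b x" "x \<in> {p, q}"
      using unique[OF TD(2,1)[OF B(1)]] by blast+
    then have "B = b p \<or> B = b q"
      by blast
    moreover have "b p \<noteq> b q"
      using b(2)[OF pq(1)] b(2)[OF pq(2)] pq(3) by auto
    then have "disjnt (b p) (b q)"
      using T(2) mem by (auto simp: pairwise_def)
    ultimately show ?thesis
      using B(2) by (auto simp: disjnt_def)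
  qed
  obtain S where "S \<subseteq> G" "card S = 3"
    using obtain_subset_with_card_n[OF G3] by blast
  then obtain x y z where "x \<in> G" "y \<in> G" "z \<in> G" "x \<noteq> y" "x \<noteq> z" "y \<noteq> z"
    by (auto simp: card_3_iff)
  then show False
    using exactly_one by metis
qed

text \<open>Blocks are at least as many as traces. If one singleton occurs and another is missing,
  the traces outnumber \<open>G\<close>; if none is missing, then without an extra block
  \<open>ex_pure_block\<close> applies to each column of \<open>C\<close>.\<close>

lemma card_group_blocks:
  assumes fin: "finite \<B>" "finite G" and G3: "3 \<le> card G"
    and D: "G \<inter> D = {}" "C \<subseteq> D"
    and dec: "\<And>p q. p \<in> G \<Longrightarrow> q \<in> G \<Longrightarrow> p \<noteq> q \<Longrightarrow> decomposes \<B> ({p, q} \<union> C)"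
  shows "card G \<le> card (group_blocks \<B> G D)"
    and "\<lbrakk>x \<in> G; {x} \<in> (\<lambda>B. B \<inter> G) ` group_blocks \<B> G D\<rbrakk> \<Longrightarrow>
      card G < card (group_blocks \<B> G D) \<or> purely_covered \<B> C"
proof -
  define \<T> where "\<T> = (\<lambda>B. B \<inter> G) ` group_blocks \<B> G D"
  have finN: "finite (group_blocks \<B> G D)"
    using fin by (simp add: group_blocks_def)
  then have finT: "finite \<T>" and le: "card \<T> \<le> card (group_blocks \<B> G D)"
    by (simp_all add: \<T>_def card_image_le)
  note pairs = group_blocks_pair_trace[OF dec _ _ D, folded \<T>_def]
  show "card G \<le> card (group_blocks \<B> G D)"
    using card_pair_traces(1)[OF finT fin(2) G3 pairs] le by simp
  show "card G < card (group_blocks \<B> G D) \<or> purely_covered \<B> C"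
    if x: "x \<in> G" "{x} \<in> (\<lambda>B. B \<inter> G) ` group_blocks \<B> G D"
  proof (cases "\<forall>p\<in>G. {p} \<in> \<T>")
    case True
    have "\<exists>B\<in>\<B>. c \<in> B \<and> B \<subseteq> C" if c: "c \<in> C" and few: "card (group_blocks \<B> G D) \<le> card G" for c
    proof (rule ex_pure_block[OF fin G3 D _ few _ c])
      show "decomposes \<B> ({p, q} \<union> C)" if "p \<in> G" "q \<in> G" "p \<noteq> q" for p q
        by (rule dec[OF that])
      show "{p} \<in> (\<lambda>B. B \<inter> G) ` group_blocks \<B> G D" if "p \<in> G" for p
        using True that by (simp add: \<T>_def)
    qed
    then show ?thesis
      unfolding purely_covered_def by (meson not_less)
  next
    case False
    then obtain p0 where "p0 \<in> G" "{p0} \<notin> \<T>"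
      by blast
    then have "card G < card \<T>"
      using card_pair_traces(2)[OF finT fin(2) G3 pairs] x unfolding \<T>_def by blast
    with le show ?thesis
      by simp
  qed
qed

text \<open>In each of the three rows the block through \<open>x\<close> contains \<open>q j\<close>
  or \<open>s j\<close>, since otherwise it would have the excluded trace \<open>{x}\<close>. These
  points differ from row to row, and so do the blocks.\<close>

lemma card_mixed_blocks:
  fixes x :: 'a and q s :: "nat \<Rightarrow> 'a"
  assumes fin: "finite \<B>" and x: "x \<in> G" and D: "G \<inter> D = {}"
    and dec: "\<And>j. j < 3 \<Longrightarrow> decomposes \<B> ({x, q j, s j} \<union> D)"
    and inj: "inj_on q {..<3}" "inj_on s {..<3}"
    and disj: "q ` {..<3} \<inter> (G \<union> D) = {}" "s ` {..<3} \<inter> (G \<union> D) = {}" "q ` {..<3} \<inter> s ` {..<3} = {}"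
    and no_single: "{x} \<notin> (\<lambda>B. B \<inter> G) ` group_blocks \<B> G D"
  shows "3 \<le> card {B \<in> \<B>. B \<inter> G \<noteq> {} \<and> \<not> B \<subseteq> G \<union> D}"
proof -
  have "\<exists>B. B \<in> \<B> \<and> x \<in> B \<and> B \<subseteq> {x, q j, s j} \<union> D \<and> \<not> B \<subseteq> G \<union> D" if j: "j < 3" for j
  proof -
    obtain B where B: "B \<in> \<B>" "x \<in> B" "B \<subseteq> {x, q j, s j} \<union> D"
      using dec[OF j] unfolding decomposes_def by blast
    have "\<not> B \<subseteq> G \<union> D"
    proof
      assume *: "B \<subseteq> G \<union> D"
      then have "q j \<notin> B" "s j \<notin> B"
        using disj j by auto
      then have "B \<inter> G = {x}"
        using B x D by blast
      with * B x no_single show False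
        unfolding group_blocks_def by blast
    qed
    with B show ?thesis by blast
  qed
  then obtain \<beta> where \<beta>: "\<And>j. j < 3 \<Longrightarrow> \<beta> j \<in> \<B>" "\<And>j. j < 3 \<Longrightarrow> x \<in> \<beta> j"
    "\<And>j. j < 3 \<Longrightarrow> \<beta> j \<subseteq> {x, q j, s j} \<union> D" "\<And>j. j < 3 \<Longrightarrow> \<not> \<beta> j \<subseteq> G \<union> D"
    by metis
  have "inj_on \<beta> {..<3}"
  proof (rule inj_onI)
    fix i j :: nat assume ij: "i \<in> {..<3}" "j \<in> {..<3}" "\<beta> i = \<beta> j"
    then have lt: "i < 3" "j < 3"
      by auto
    obtain y where y: "y \<in> \<beta> i" "y \<notin> G \<union> D"
      using \<beta>(4)[OF lt(1)] by blast
    then have "y = q i \<or> y = s i" "y = q j \<or> y = s j"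
      using \<beta>(3)[OF lt(1)] \<beta>(3)[OF lt(2)] ij(3) x by blast+
    moreover have "q i \<noteq> s j" "q j \<noteq> s i"
      using disj(3) ij by blast+
    ultimately show "i = j"
      using inj ij by (auto dest: inj_onD)
  qed
  moreover have "\<beta> ` {..<3} \<subseteq> {B \<in> \<B>. B \<inter> G \<noteq> {} \<and> \<not> B \<subseteq> G \<union> D}"
  proof (rule image_subsetI)
    show "\<beta> j \<in> {B \<in> \<B>. B \<inter> G \<noteq> {} \<and> \<not> B \<subseteq> G \<union> D}" if "j \<in> {..<3}" for j
      using \<beta>(1,2,4)[of j] x that by blast
  qed
  ultimately show ?thesis
    using card_inj_on_le[of \<beta> "{..<3}"] fin by simp
qed

subsection \<open>Rank gaps\<close>

text \<open>Each diagonal position has an inner index with a positive term. If \<open>a\<close> and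
  \<open>b\<close> shared one, both \<open>F a b\<close> and \<open>F b a\<close> would be nonzero;
  so the choice of indices is injective.\<close>

lemma fooling_set_le:
  assumes fact: "factorizes {0..} r n m F" and s: "s \<le> n" "s \<le> m"
    and diag: "\<And>a. a < s \<Longrightarrow> F a a \<noteq> 0"
    and off: "\<And>a b. a < s \<Longrightarrow> b < s \<Longrightarrow> a \<noteq> b \<Longrightarrow> F a b = 0 \<or> F b a = 0"
  shows "s \<le> r"
proof -
  obtain U V where U: "\<forall>i<n. \<forall>k<r. U i k \<in> {0 :: real..}" and V: "\<forall>k<r. \<forall>j<m. V k j \<in> {0 :: real..}"
    and F: "\<forall>i<n. \<forall>j<m. F i j = (\<Sum>k<r. U i k * V k j)"
    using fact unfolding factorizes_def by blast
  have nz: "F i j \<noteq> 0" if "i < n" "j < m" "k < r" "U i k \<noteq> 0" "V k j \<noteq> 0" for i j k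
  proof -
    have "0 \<le> U i l * V l j" if "l < r" for l
      using U V \<open>i < n\<close> \<open>j < m\<close> that by auto
    then have "U i k * V k j \<le> F i j"
      using F that by (auto intro!: member_le_sum)
    moreover have "0 < U i k" "0 < V k j"
      using U V that by (simp_all add: less_le)
    then have "0 < U i k * V k j"
      by (rule mult_pos_pos)
    ultimately show ?thesis
      by linarith
  qed
  have "\<exists>k<r. U a k \<noteq> 0 \<and> V k a \<noteq> 0" if a: "a < s" for a
  proof (rule ccontr)
    assume "\<not> ?thesis"
    then have "(\<Sum>k<r. U a k * V k a) = 0"
      by (intro sum.neutral) auto
    then show False
      using F diag[OF a] a s by auto
  qed
  then obtain c where c: "\<And>a. a < s \<Longrightarrow> c a < r \<and> U a (c a) \<noteq> 0 \<and> V (c a) a \<noteq> 0"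
    by metis
  have "inj_on c {..<s}"
  proof (rule inj_onI)
    fix a b assume ab: "a \<in> {..<s}" "b \<in> {..<s}" "c a = c b"
    then have "F a b \<noteq> 0" "F b a \<noteq> 0"
      using nz[of a b "c a"] nz[of b a "c a"] c[of a] c[of b] s by auto
    then show "a = b"
      using off[of a b] ab by auto
  qed
  then show ?thesis
    using card_inj_on_le[of c "{..<s}" "{..<r}"] c by auto
qed

section \<open>Ranks of incidence matrices\<close>

definition incidence :: "nat list list \<Rightarrow> nat \<Rightarrow> nat \<Rightarrow> real" where
  "incidence Rs i j = (if j \<in> set (Rs ! i) then 1 else 0)"

definition incidence_mat :: "nat list list \<Rightarrow> nat \<Rightarrow> real mat" where
  "incidence_mat Rs m = mat (length Rs) m (\<lambda>(i, j). incidence Rs i j)"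

lemma zero_one_incidence_mat: "zero_one_mat (incidence_mat Rs m)"
  unfolding zero_one_mat_def incidence_mat_def by (auto dest!: elements_matD simp: incidence_def split: if_splits)

lemma factorizes_incidence_mat_iff:
  "factorizes A r (dim_row (incidence_mat Rs m)) (dim_col (incidence_mat Rs m))
      (\<lambda>i j. incidence_mat Rs m $$ (i, j)) \<longleftrightarrow>
    factorizes A r (length Rs) m (incidence Rs)"
  unfolding factorizes_def by (simp add: incidence_mat_def)

text \<open>The first \<open>s\<close> columns serve as left factor; the right factor is an identity
  matrix continued by the weights \<open>W\<close>, which express the other columns. By
  \<open>diag\<close> and \<open>off\<close>, the first \<open>s\<close> diagonal positions form a
  fooling set.\<close>

lemma nonneg_rank_incidence_mat_eq:
  fixes W :: "nat \<Rightarrow> nat \<Rightarrow> real"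
  assumes s: "s \<le> length Rs" "s \<le> m"
    and combination: "\<And>R j. R \<in> set Rs \<Longrightarrow> s \<le> j \<Longrightarrow> j < m \<Longrightarrow>
      (\<Sum>k<s. if k \<in> set R then W k j else 0) = (if j \<in> set R then 1 else 0)"
    and W: "\<And>k j. 0 \<le> W k j"
    and diag: "\<And>a. a < s \<Longrightarrow> a \<in> set (Rs ! a)"
    and off: "\<And>a b. a < s \<Longrightarrow> b < s \<Longrightarrow> a \<noteq> b \<Longrightarrow> a \<notin> set (Rs ! b) \<or> b \<notin> set (Rs ! a)"
  shows "nonneg_rank (incidence_mat Rs m) = s"
proof (rule antisym)
  define V where "V k j = (if j < s then if k = j then 1 else 0 else W k j)" for k j
  have "(\<Sum>k<s. incidence Rs i k * V k j) = incidence Rs i j" if "i < length Rs" "j < m" for i j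
  proof (cases "j < s")
    case True
    have "(\<Sum>k<s. incidence Rs i k * V k j) = (\<Sum>k<s. if k = j then incidence Rs i j else 0)"
      using True by (intro sum.cong) (auto simp: V_def)
    with True show ?thesis
      by simp
  next
    case False
    then have "(\<Sum>k<s. incidence Rs i k * V k j) = (\<Sum>k<s. if k \<in> set (Rs ! i) then W k j else 0)"
      by (intro sum.cong) (auto simp: V_def incidence_def)
    also have "\<dots> = incidence Rs i j"
      unfolding incidence_def using False that by (intro combination) auto
    finally show ?thesis .
  qed
  then have "factorizes {0..} s (length Rs) m (incidence Rs)"
    unfolding factorizes_def by (intro exI[of _ "incidence Rs"] exI[of _ V]) (simp add: V_def W incidence_def)
  then show "nonneg_rank (incidence_mat Rs m) \<le> s"
    by (intro nonneg_rank_le) (simp only: factorizes_incidence_mat_iff)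
  have "factorizes {0..} (nonneg_rank (incidence_mat Rs m)) (length Rs) m (incidence Rs)"
    using factorizes_nonneg_rank[OF zero_one_incidence_mat[of Rs m]]
    by (simp only: factorizes_incidence_mat_iff)
  then show "s \<le> nonneg_rank (incidence_mat Rs m)"
    by (rule fooling_set_le[OF _ s]) (use diag off in \<open>auto simp: incidence_def\<close>)
qed

text \<open>The identity matrix as right factor gives the upper bound, so everything rests on the
  block count in \<open>bound\<close>.\<close>

lemma binary_rank_incidence_mat_eq:
  assumes Rs: "\<And>R. R \<in> set Rs \<Longrightarrow> set R \<subseteq> {..<m}"
    and bound: "\<And>\<B>. finite \<B> \<Longrightarrow> (\<And>R. R \<in> set Rs \<Longrightarrow> decomposes \<B> (set R)) \<Longrightarrow> m \<le> card \<B>"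
  shows "binary_rank (incidence_mat Rs m) = m"
proof (rule antisym)
  have "(\<Sum>k<m. incidence Rs i k * (if k = j then 1 else 0)) = incidence Rs i j" if "j < m" for i j
  proof -
    have "(\<Sum>k<m. incidence Rs i k * (if k = j then 1 else 0)) = (\<Sum>k<m. if k = j then incidence Rs i j else 0)"
      by (intro sum.cong) auto
    with that show ?thesis
      by simp
  qed
  then have "factorizes {0, 1} m (length Rs) m (incidence Rs)"
    unfolding factorizes_def
    by (intro exI[of _ "incidence Rs"] exI[of _ "\<lambda>k j. if k = j then 1 else 0"])
      (simp add: incidence_def)
  then show "binary_rank (incidence_mat Rs m) \<le> m"
    by (intro binary_rank_le) (simp only: factorizes_incidence_mat_iff)
  have "factorizes {0, 1} (binary_rank (incidence_mat Rs m)) (length Rs) m (incidence Rs)"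
    using factorizes_binary_rank[OF zero_one_incidence_mat[of Rs m]]
    by (simp only: factorizes_incidence_mat_iff)
  then obtain \<B> where \<B>: "finite \<B>" "card \<B> \<le> binary_rank (incidence_mat Rs m)"
    "\<forall>i<length Rs. decomposes \<B> (set (Rs ! i))"
    using factorizes_imp_decomposes[of _ "length Rs" m "\<lambda>i. set (Rs ! i)"] Rs
    unfolding incidence_def[abs_def] by (metis nth_mem)
  have "m \<le> card \<B>"
    using \<B>(3) by (intro bound[OF \<B>(1)]) (metis in_set_conv_nth)
  with \<B>(2) show "m \<le> binary_rank (incidence_mat Rs m)"
    by simp
qed

text \<open>The edges of the complete graph on \<open>{0, 1, 2, 3}\<close>; the additional column \<open>4\<close> is half
  the sum of the others. The first four rows form a cycle, listed so that the diagonal is a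
  fooling set; likewise the first nine rows of the next example.\<close>

definition rows_4_5 :: "nat list list" where
  "rows_4_5 = [[0, 1, 4], [1, 2, 4], [2, 3, 4], [3, 0, 4], [0, 2, 4], [1, 3, 4]]"

lemma nonneg_rank_4: "nonneg_rank (incidence_mat rows_4_5 5) = 4"
proof (rule nonneg_rank_incidence_mat_eq[where W = "\<lambda>_ _. 1 / 2"])
  show "(\<Sum>k<4. if k \<in> set R then 1 / 2 else 0) = (if j \<in> set R then 1 else (0 :: real))"
    if "R \<in> set rows_4_5" "4 \<le> j" "j < 5" for R j
  proof -
    have "j = 4"
      using that by simp
    with that(1) show ?thesis
      by (auto simp: rows_4_5_def eval_nat_numeral)
  qed
  show "a \<in> set (rows_4_5 ! a)" if "a < 4" for a
  proof -
    have "a \<in> {0, 1, 2, 3}"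
      using that by auto
    then show ?thesis
      by (auto simp: rows_4_5_def)
  qed
  show "a \<notin> set (rows_4_5 ! b) \<or> b \<notin> set (rows_4_5 ! a)" if "a < 4" "b < 4" "a \<noteq> b" for a b
  proof -
    have "a \<in> {0, 1, 2, 3}" "b \<in> {0, 1, 2, 3}"
      using that by auto
    with \<open>a \<noteq> b\<close> show ?thesis
      by (auto simp: rows_4_5_def)
  qed
qed (simp_all add: rows_4_5_def)

text \<open>The four points form a single group. A singleton trace leads to five group blocks, or to
  a pure block on column 4 next to at least four group blocks. Without singleton traces every pair
  of points is a trace.\<close>

lemma binary_rank_5: "binary_rank (incidence_mat rows_4_5 5) = 5"
proof (rule binary_rank_incidence_mat_eq)
  show "set R \<subseteq> {..<5}" if "R \<in> set rows_4_5" for R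
    using that by (auto simp: rows_4_5_def)
next
  fix \<B> :: "nat set set"
  assume fin: "finite \<B>" and "\<And>R. R \<in> set rows_4_5 \<Longrightarrow> decomposes \<B> (set R)"
  then have "\<forall>R\<in>set rows_4_5. decomposes \<B> (set R)"
    by blast
  then have rows: "decomposes \<B> {0, 1, 4}" "decomposes \<B> {1, 2, 4}" "decomposes \<B> {2, 3, 4}"
    "decomposes \<B> {0, 3, 4}" "decomposes \<B> {0, 2, 4}" "decomposes \<B> {1, 3, 4}"
    by (simp_all add: rows_4_5_def insert_commute)
  define G :: "nat set" where "G = {0, 1, 2, 3}"
  have dec: "decomposes \<B> ({p, q} \<union> {4})" if "p \<in> G" "q \<in> G" "p \<noteq> q" for p q
    using that rows by (auto simp: G_def insert_commute)
  have G: "finite G" "3 \<le> card G" "G \<inter> {4} = {}" "card G = 4"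
    by (auto simp: G_def)
  define N where "N = group_blocks \<B> G {4}"
  have N: "finite N" "N \<subseteq> \<B>"
    using fin by (auto simp: N_def group_blocks_def)
  show "5 \<le> card \<B>"
  proof (cases "\<exists>x\<in>G. {x} \<in> (\<lambda>B. B \<inter> G) ` N")
    case True
    then have "4 < card N \<or> purely_covered \<B> {4}"
      using card_group_blocks(2)[OF fin G(1,2,3) order_refl dec] unfolding N_def G(4) by blast
    then show ?thesis
    proof
      assume "4 < card N"
      then show ?thesis
        using card_mono[OF fin N(2)] by simp
    next
      assume "purely_covered \<B> {4}"
      then obtain B where "B \<in> \<B>" "B \<subseteq> {4}"
        by (auto simp: purely_covered_def)
      then have "insert B N \<subseteq> \<B>" "B \<notin> N"
        using N(2) by (auto simp: N_def group_blocks_def G_def)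
      then have "Suc (card N) \<le> card \<B>"
        using card_mono[OF fin, of "insert B N"] N(1) by simp
      then show ?thesis
        using card_group_blocks(1)[OF fin G(1,2,3) order_refl dec] unfolding N_def G(4) by simp
    qed
  next
    case False
    then have "{p, q} \<in> (\<lambda>B. B \<inter> G) ` N" if "p \<in> G" "q \<in> G" "p \<noteq> q" for p q
      using group_blocks_pair_trace[OF dec[OF that] that(1,2) G(3) order_refl] that
      unfolding N_def by blast
    \<comment> \<open>Five of the six pairs suffice.\<close>
    then have "{{0, 1}, {0, 2}, {0, 3}, {1, 2}, {1, 3}} \<subseteq> (\<lambda>B. B \<inter> G) ` N"
      by (simp add: G_def)
    then have "card {{0, 1}, {0, 2}, {0, 3}, {1, 2}, {1, 3 :: nat}} \<le> card ((\<lambda>B. B \<inter> G) ` N)"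
      using N(1) by (intro card_mono) auto
    also have "\<dots> \<le> card N"
      by (rule card_image_le[OF N(1)])
    also have "\<dots> \<le> card \<B>"
      by (rule card_mono[OF fin N(2)])
    finally show ?thesis
      by (simp add: doubleton_eq_iff)
  qed
qed

text \<open>Nine points in three groups \<open>{0, 1, 2}\<close>, \<open>{3, 4, 5}\<close>, \<open>{6, 7, 8}\<close>. A row picks either two
  points of one group or one point of each group; every row thus meets the complement of the
  \<open>g\<close>-th group in no or two points, and the additional column \<open>9 + g\<close> is half the sum
  of the six columns outside the \<open>g\<close>-th group.\<close>

definition rows_9_12 :: "nat list list" where
  "rows_9_12 = [[0, 1, 10, 11], [1, 2, 10, 11], [2, 0, 10, 11],
    [3, 4, 9, 11], [4, 5, 9, 11], [5, 3, 9, 11],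
    [6, 7, 9, 10], [7, 8, 9, 10], [8, 6, 9, 10],
    [0, 3, 6, 9, 10, 11], [0, 4, 7, 9, 10, 11], [0, 5, 8, 9, 10, 11],
    [1, 3, 7, 9, 10, 11], [2, 3, 8, 9, 10, 11],
    [1, 4, 6, 9, 10, 11], [2, 5, 6, 9, 10, 11]]"

lemma nonneg_rank_9: "nonneg_rank (incidence_mat rows_9_12 12) = 9"
\<comment> \<open>\<open>k div 3\<close> is the group of the point \<open>k\<close>, and
  \<open>j - 9\<close> is the group left out by column \<open>j\<close>.\<close>
proof (rule nonneg_rank_incidence_mat_eq[where W = "\<lambda>k j. if k div 3 = j - 9 then 0 else 1 / 2"])
  show "(\<Sum>k<9. if k \<in> set R then if k div 3 = j - 9 then 0 else 1 / 2 else 0)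
      = (if j \<in> set R then 1 else (0 :: real))"
    if "R \<in> set rows_9_12" "9 \<le> j" "j < 12" for R j
  proof -
    have sum9: "(\<Sum>k<9. f k) = f 0 + f 1 + f 2 + f 3 + f 4 + f 5 + f 6 + f 7 + f 8" for f :: "nat \<Rightarrow> real"
      by (simp add: eval_nat_numeral)
    have "\<forall>R\<in>set rows_9_12. \<forall>j\<in>{9, 10, 11}.
        (\<Sum>k<9. if k \<in> set R then if k div 3 = j - 9 then 0 else 1 / 2 else 0)
        = (if j \<in> set R then 1 else (0 :: real))"
      by (simp add: sum9 rows_9_12_def)
    moreover have "j \<in> {9, 10, 11}"
      using that by auto
    ultimately show ?thesis
      using that(1) by blast
  qed
  have less_9: "a \<in> {0, 1, 2, 3, 4, 5, 6, 7, 8}" if "a < 9" for a :: nat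
    using that by auto
  show "a \<in> set (rows_9_12 ! a)" if "a < 9" for a
    using less_9[OF that] by (auto simp: rows_9_12_def)
  show "a \<notin> set (rows_9_12 ! b) \<or> b \<notin> set (rows_9_12 ! a)" if "a < 9" "b < 9" "a \<noteq> b" for a b
    using less_9[OF that(1)] less_9[OF that(2)] \<open>a \<noteq> b\<close> by (auto simp: rows_9_12_def)
qed (simp_all add: rows_9_12_def)

section \<open>Block count for the matrix with twelve columns\<close>

lemma card_ge_3I: "finite P \<Longrightarrow> a \<in> P \<Longrightarrow> b \<in> P \<Longrightarrow> c \<in> P \<Longrightarrow> a \<noteq> b \<Longrightarrow> a \<noteq> c \<Longrightarrow> b \<noteq> c \<Longrightarrow> 3 \<le> card P"
  using card_mono[of P "{a, b, c}"] by simp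

lemma card_ge_2I: "finite P \<Longrightarrow> a \<in> P \<Longrightarrow> b \<in> P \<Longrightarrow> a \<noteq> b \<Longrightarrow> 2 \<le> card P"
  using card_mono[of P "{a, b}"] by simp

lemma card_ge_1I: "finite P \<Longrightarrow> a \<in> P \<Longrightarrow> 1 \<le> card P"
  using card_mono[of P "{a}"] by simp

text \<open>A block through \<open>b\<close> inside \<open>{b, c}\<close> differs from any block
  inside \<open>{a, c}\<close>.\<close>

lemma card_pure_blocks_two:
  assumes fin: "finite \<B>" and dist: "a \<noteq> b" "a \<noteq> c" "b \<noteq> c"
    and pure: "purely_covered \<B> {b, c}" "purely_covered \<B> {a, c}"
  shows "2 \<le> card {B \<in> \<B>. B \<noteq> {} \<and> B \<subseteq> {a, b, c}}"
proof -
  obtain B B' where "B \<in> \<B>" "b \<in> B" "B \<subseteq> {b, c}" "B' \<in> \<B>" "a \<in> B'" "B' \<subseteq> {a, c}"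
    using pure unfolding purely_covered_def by blast
  then show ?thesis
    by (intro card_ge_2I[of _ B B']) (use fin dist in auto)
qed

lemma card_pure_blocks_three:
  assumes fin: "finite \<B>" and dist: "a \<noteq> b" "a \<noteq> c" "b \<noteq> c"
    and pure: "purely_covered \<B> {b, c}" "purely_covered \<B> {a, c}" "purely_covered \<B> {a, b}"
  shows "3 \<le> card {B \<in> \<B>. B \<noteq> {} \<and> B \<subseteq> {a, b, c}}"
proof -
  have two: "{x} \<in> \<B> \<or> {x, y} \<in> \<B>" if pure: "purely_covered \<B> {x, y}" for x y
  proof -
    obtain B where B: "B \<in> \<B>" "x \<in> B" "B \<subseteq> {x, y}"
      using pure unfolding purely_covered_def by blast
    then have "B = {x} \<or> B = {x, y}"
      by blast
    with B(1) show ?thesis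
      by blast
  qed
  have s: "{a} \<in> \<B> \<or> {a, b} \<in> \<B>" "{a} \<in> \<B> \<or> {a, c} \<in> \<B>" "{b} \<in> \<B> \<or> {a, b} \<in> \<B>"
    "{b} \<in> \<B> \<or> {b, c} \<in> \<B>" "{c} \<in> \<B> \<or> {a, c} \<in> \<B>" "{c} \<in> \<B> \<or> {b, c} \<in> \<B>"
    using two[of a b] two[of a c] two[of b a] two[of b c] two[of c a] two[of c b] pure
    by (simp_all add: insert_commute)
  define P where "P = {B \<in> \<B>. B \<noteq> {} \<and> B \<subseteq> {a, b, c}}"
  have finP: "finite P"
    using fin by (simp add: P_def)
  have three: "3 \<le> card P" if "X \<in> \<B>" "Y \<in> \<B>" "Z \<in> \<B>" "X \<noteq> Y" "X \<noteq> Z" "Y \<noteq> Z"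
    "\<forall>S\<in>{X, Y, Z}. S \<noteq> {} \<and> S \<subseteq> {a, b, c}" for X Y Z
    using that by (intro card_ge_3I[OF finP, of X Y Z]) (auto simp: P_def)
  \<comment> \<open>If a singleton is missing, both pairs through its point are blocks, and a block
    covering one of the other points within the opposite pair or alone is a third, except where the
    listed alternatives already coincide.\<close>
  consider "{a} \<in> \<B>" "{b} \<in> \<B>" "{c} \<in> \<B>"
    | "{a, b} \<in> \<B>" "{a, c} \<in> \<B>" "{b} \<in> \<B>" | "{a, b} \<in> \<B>" "{a, c} \<in> \<B>" "{b, c} \<in> \<B>"
    | "{a, b} \<in> \<B>" "{b, c} \<in> \<B>" "{a} \<in> \<B>" | "{a, c} \<in> \<B>" "{b, c} \<in> \<B>" "{a} \<in> \<B>"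
    using s by argo
  then have "3 \<le> card P"
  proof cases
    case 1
    then show ?thesis
      by (rule three) (use dist in \<open>auto simp: doubleton_eq_iff\<close>)
  next
    case 2
    then show ?thesis
      by (rule three) (use dist in \<open>auto simp: doubleton_eq_iff\<close>)
  next
    case 3
    then show ?thesis
      by (rule three) (use dist in \<open>auto simp: doubleton_eq_iff\<close>)
  next
    case 4
    then show ?thesis
      by (rule three) (use dist in \<open>auto simp: doubleton_eq_iff\<close>)
  next
    case 5
    then show ?thesis
      by (rule three) (use dist in \<open>auto simp: doubleton_eq_iff\<close>)
  qed
  then show ?thesis
    by (simp add: P_def)
qed

lemma card_disjoint_families_le:
  assumes "finite \<B>" "N0 \<subseteq> \<B>" "N1 \<subseteq> \<B>" "N2 \<subseteq> \<B>" "Y \<subseteq> \<B>"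
    and "N0 \<inter> N1 = {}" "N0 \<inter> N2 = {}" "N1 \<inter> N2 = {}" "N0 \<inter> Y = {}" "N1 \<inter> Y = {}" "N2 \<inter> Y = {}"
  shows "card N0 + card N1 + card N2 + card Y \<le> card \<B>"
proof -
  have "finite N0" "finite N1" "finite N2" "finite Y"
    using assms(1-5) by (auto intro: finite_subset)
  then have "card (N0 \<union> N1 \<union> N2 \<union> Y) = card N0 + card N1 + card N2 + card Y"
    using assms(6-) by (simp add: card_Un_disjoint Int_Un_distrib2)
  then show ?thesis
    using card_mono[of \<B> "N0 \<union> N1 \<union> N2 \<union> Y"] assms(1-5) by simp
qed

text \<open>The three groups have at least three blocks each, so three more are needed. If
  \<open>{0}\<close>, \<open>{3}\<close> or \<open>{6}\<close> is missing among the traces of its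
  group, mixed blocks supply them. Otherwise each group has a fourth block or a purely covered pair
  of additional columns, and these pairs yield as many pure blocks as there are such groups.\<close>

lemma binary_rank_12: "binary_rank (incidence_mat rows_9_12 12) = 12"
proof (rule binary_rank_incidence_mat_eq)
  show "set R \<subseteq> {..<12}" if "R \<in> set rows_9_12" for R
    using that by (auto simp: rows_9_12_def)
next
  fix \<B> :: "nat set set"
  assume fin: "finite \<B>" and "\<And>R. R \<in> set rows_9_12 \<Longrightarrow> decomposes \<B> (set R)"
  then have rows: "\<forall>R\<in>set rows_9_12. decomposes \<B> (set R)"
    by blast
  define D :: "nat set" where "D = {9, 10, 11}"
  define G0 G1 G2 :: "nat set" where "G0 = {0, 1, 2}" and "G1 = {3, 4, 5}" and "G2 = {6, 7, 8}"
  define N0 N1 N2 where "N0 = group_blocks \<B> G0 D" and "N1 = group_blocks \<B> G1 D"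
    and "N2 = group_blocks \<B> G2 D"
  have pairs0:
    "decomposes \<B> ({p, q} \<union> {10, 11})" if "p \<in> G0" "q \<in> G0" "p \<noteq> q" for p q
    using rows that by (auto simp: rows_9_12_def G0_def insert_commute)
  have pairs1:
    "decomposes \<B> ({p, q} \<union> {9, 11})" if "p \<in> G1" "q \<in> G1" "p \<noteq> q" for p q
    using rows that by (auto simp: rows_9_12_def G1_def insert_commute)
  have pairs2:
    "decomposes \<B> ({p, q} \<union> {9, 10})" if "p \<in> G2" "q \<in> G2" "p \<noteq> q" for p q
    using rows that by (auto simp: rows_9_12_def G2_def insert_commute)
  have sub: "{10, 11} \<subseteq> D" "{9, 11} \<subseteq> D" "{9, 10} \<subseteq> D"
    by (auto simp: D_def)
  have G: "finite G0" "3 \<le> card G0" "G0 \<inter> D = {}" "finite G1" "3 \<le> card G1" "G1 \<inter> D = {}"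
    "finite G2" "3 \<le> card G2" "G2 \<inter> D = {}" "card G0 = 3" "card G1 = 3" "card G2 = 3"
    "G0 \<inter> G1 = {}" "G0 \<inter> G2 = {}" "G1 \<inter> G2 = {}"
    by (auto simp: G0_def G1_def G2_def D_def)
  have N_sub: "N0 \<subseteq> \<B>" "N1 \<subseteq> \<B>" "N2 \<subseteq> \<B>"
    by (auto simp: N0_def N1_def N2_def group_blocks_def)
  have group_disjoint: "group_blocks \<B> G D \<inter> group_blocks \<B> G' D = {}"
    if "G \<inter> G' = {}" "G \<inter> D = {}" for G G'
    unfolding group_blocks_def using that by blast
  have N_disjoint: "N0 \<inter> N1 = {}" "N0 \<inter> N2 = {}" "N1 \<inter> N2 = {}"
    unfolding N0_def N1_def N2_def by (rule group_disjoint; use G in blast)+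
  \<comment> \<open>The fourth family stays open: it will be the mixed blocks of one group or the
    pure blocks.\<close>
  note total = card_disjoint_families_le[OF fin N_sub _ N_disjoint]
  have ge: "3 \<le> card N0" "3 \<le> card N1" "3 \<le> card N2"
    using card_group_blocks(1)[OF fin G(1-3) sub(1) pairs0] card_group_blocks(1)[OF fin G(4-6) sub(2) pairs1]
      card_group_blocks(1)[OF fin G(7-9) sub(3) pairs2]
    unfolding N0_def N1_def N2_def G(10-12) by blast+
  define X where "X G = {B \<in> \<B>. B \<inter> G \<noteq> {} \<and> \<not> B \<subseteq> G \<union> D}" for G
  have X_bound: "12 \<le> card \<B>" if "3 \<le> card (X G)" "G = G0 \<or> G = G1 \<or> G = G2" for G
  proof -
    have "group_blocks \<B> G' D \<inter> X G = {}" if "G' = G \<or> G \<inter> G' = {} \<and> G \<inter> D = {}" for G'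
      unfolding group_blocks_def X_def using that by blast
    then have "N0 \<inter> X G = {}" "N1 \<inter> X G = {}" "N2 \<inter> X G = {}"
      using that(2) G unfolding N0_def N1_def N2_def by (metis Int_commute)+
    then show ?thesis
      using total[of "X G"] ge that(1) by (auto simp: X_def)
  qed
  have less_3: "j = 0 \<or> j = 1 \<or> j = 2" if "j < 3" for j :: nat
    using that by auto
  have img: "f ` {..<3} = {f 0, f 1, f 2}" for f :: "nat \<Rightarrow> nat"
    by (auto simp: numeral_3_eq_3 numeral_2_eq_2 lessThan_Suc)
  \<comment> \<open>The points 0, 3 and 6 are those that lie in three rows with one point per group,
    as \<open>card_mixed_blocks\<close> requires.\<close>
  consider "{0} \<notin> (\<lambda>B. B \<inter> G0) ` N0" | "{3} \<notin> (\<lambda>B. B \<inter> G1) ` N1" | "{6} \<notin> (\<lambda>B. B \<inter> G2) ` N2"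
    | "{0} \<in> (\<lambda>B. B \<inter> G0) ` N0" "{3} \<in> (\<lambda>B. B \<inter> G1) ` N1" "{6} \<in> (\<lambda>B. B \<inter> G2) ` N2"
    by blast
  then show "12 \<le> card \<B>"
  proof cases
    case 1
    have "3 \<le> card (X G0)"
      unfolding X_def
    proof (rule card_mixed_blocks[where x = 0 and q = "\<lambda>j. 3 + j" and s = "\<lambda>j. 6 + j", OF fin])
      show "decomposes \<B> ({0, 3 + j, 6 + j} \<union> D)" if "j < 3" for j
        using rows less_3[OF that] by (auto simp: rows_9_12_def D_def insert_commute)
    qed (use 1 in \<open>auto simp: img G0_def D_def inj_on_def N0_def\<close>)
    then show ?thesis
      by (rule X_bound) simp
  next
    case 2
    have "3 \<le> card (X G1)"
      unfolding X_def
    proof (rule card_mixed_blocks[where x = 3 and q = "\<lambda>j. j" and s = "\<lambda>j. 6 + j", OF fin])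
      show "decomposes \<B> ({3, j, 6 + j} \<union> D)" if "j < 3" for j
        using rows less_3[OF that] by (auto simp: rows_9_12_def D_def insert_commute)
    qed (use 2 in \<open>auto simp: img G1_def D_def inj_on_def N1_def\<close>)
    then show ?thesis
      by (rule X_bound) simp
  next
    case 3
    have "3 \<le> card (X G2)"
      unfolding X_def
    proof (rule card_mixed_blocks[where x = 6 and q = "\<lambda>j. j" and s = "\<lambda>j. 3 + j", OF fin])
      show "decomposes \<B> ({6, j, 3 + j} \<union> D)" if "j < 3" for j
        using rows less_3[OF that] by (auto simp: rows_9_12_def D_def insert_commute)
    qed (use 3 in \<open>auto simp: img G2_def D_def inj_on_def N2_def\<close>)
    then show ?thesis
      by (rule X_bound) simp
  next
    case 4
    define P where "P = {B \<in> \<B>. B \<noteq> {} \<and> B \<subseteq> {9, 10, 11}}"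
    have finP: "finite P"
      using fin by (simp add: P_def)
    have "group_blocks \<B> G D \<inter> P = {}" if "G \<inter> D = {}" for G
      using that unfolding group_blocks_def P_def D_def by blast
    then have "N0 \<inter> P = {}" "N1 \<inter> P = {}" "N2 \<inter> P = {}"
      using G unfolding N0_def N1_def N2_def by blast+
    then have sum: "card N0 + card N1 + card N2 + card P \<le> card \<B>"
      by (intro total) (auto simp: P_def)
    define pure where "pure = purely_covered \<B>"
    have "(0 :: nat) \<in> G0" "(3 :: nat) \<in> G1" "(6 :: nat) \<in> G2"
      by (simp_all add: G0_def G1_def G2_def)
    then have alt: "3 < card N0 \<or> pure {10, 11}" "3 < card N1 \<or> pure {9, 11}" "3 < card N2 \<or> pure {9, 10}"
      using card_group_blocks(2)[OF fin G(1-3) sub(1) pairs0] card_group_blocks(2)[OF fin G(4-6) sub(2) pairs1]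
        card_group_blocks(2)[OF fin G(7-9) sub(3) pairs2] 4
      unfolding N0_def N1_def N2_def G(10-12) pure_def by blast+
    have one: "1 \<le> card P" if C: "pure C" "C \<subseteq> {9, 10, 11}" "x \<in> C" for C x
    proof -
      obtain B where "B \<in> \<B>" "x \<in> B" "B \<subseteq> C"
        using C unfolding pure_def purely_covered_def by blast
      then have "B \<in> P"
        using C(2) by (auto simp: P_def)
      then show ?thesis
        by (rule card_ge_1I[OF finP])
    qed
    have P1: "1 \<le> card P" if "pure {10, 11} \<or> pure {9, 11} \<or> pure {9, 10}"
      using that one[of "{10, 11}" 11] one[of "{9, 11}" 11] one[of "{9, 10}" 9] by auto
    have P2: "2 \<le> card P"
      if "pure {10, 11} \<and> pure {9, 11} \<or> pure {10, 11} \<and> pure {9, 10} \<or> pure {9, 11} \<and> pure {9, 10}"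
      using that card_pure_blocks_two[OF fin, of 9 10 11] card_pure_blocks_two[OF fin, of 9 11 10]
        card_pure_blocks_two[OF fin, of 10 11 9]
      unfolding pure_def P_def by (simp add: insert_commute) argo
    have P3: "3 \<le> card P" if "pure {10, 11}" "pure {9, 11}" "pure {9, 10}"
      using that card_pure_blocks_three[OF fin, of 9 10 11] unfolding pure_def P_def by simp
    show ?thesis
      using alt ge sum P1 P2 P3 by linarith
  qed
qed

theorem theorem2:
  shows "(\<forall>M :: real mat. zero_one_mat M \<longrightarrow> nonneg_rank M \<le> 3 \<longrightarrow> nonneg_rank M = binary_rank M)
    \<and> (\<exists>M :: real mat. zero_one_mat M \<and> nonneg_rank M = 4 \<and> binary_rank M = 5)
    \<and> (\<exists>M :: real mat. zero_one_mat M \<and> nonneg_rank M = 9 \<and> binary_rank M = 12)"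
  using binary_rank_eq_nonneg_rank zero_one_incidence_mat nonneg_rank_4 binary_rank_5
    nonneg_rank_9 binary_rank_12 by blast

end
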